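(* Let $(E,\mathcal D,\mathcal J)$ be a symplectic Banach triple, $\langle\cdot,\cdot\rangle$ a continuous scalar product on $E$ with norm $\|\cdot\|$ and completion $\hat E$, $H\in C^2(E,\mathbb R)\cap\mathrm{Dif}(\mathcal D,\mathcal J)$, $G$ a Lie group with a globally Hamiltonian action $\Phi$ on $E$ with $\mathrm{Ad}^*$-equivariant momentum map $F\in C^2(E,\mathbb R^m)$, and suppose $H\circ\Phi_g=H$ for all $g\in G$. Suppose that for all $g\in G$, $\Phi_g$ is linear and preserves both $\langle\cdot,\cdot\rangle$ and $\|\cdot\|_E$. Let $\Omega\subset\mathfrak g\simeq\mathbb R^m$ be open and let $\tilde u\in C^1(\Omega,E)$, $\tilde u(\xi)=u_\xi\in\mathcal D$, satisfy $D_{u_\xi}H-\xi\cdot D_{u_\xi}F=0$ for all $\xi\in\Omega$. Write $\mathcal L_\xi=H-\xi\cdot F$, $\mu_\xi=F(u_\xi)$ and $W:\Omega\to\mathbb R$, $W(\xi)=\mathcal L_\xi(u_\xi)$. Let $\xi\in\Omega$ and suppose there exist $\varepsilon,C>0$ such that $$D^2_{u_\xi}\mathcal L_\xi(v,v)\ge\varepsilon\|v\|_E^2-C\|v\|^2\qquad\forall v\in E,$$ and let $\nabla^2\mathcal L_\xi(u_\xi)$, with domain $\mathcal D(\nabla^2\mathcal L_\xi(u_\xi))$, be the associated self-adjoint operator on $\hat E$. Suppose in addition that (i) $D^2_\xi W$ is non-degenerate; (ii) $\mathrm{Ker}\,D^2_{u_\xi}\mathcal L_\xi=T_{u_\xi}\mathcal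 O_{u_\xi}$; (iii) $\inf\big(\sigma(\nabla^2\mathcal L_\xi(u_\xi))\cap(0,+\infty)\big)>0$; (iv) $p(D^2_\xi W)=n(D^2_{u_\xi}\mathcal L_\xi)$; (v) for all $u\in\mathcal O_{u_\xi}$ and all $j=1,\dots,m$ there exists $\nabla F_j(u)\in\mathcal D(\nabla^2\mathcal L_\xi(u_\xi))\subset E$ such that $D_uF_j(w)=\langle\nabla F_j(u),w\rangle$ for all $w\in E$. Then there exists $\delta>0$ such that $$\forall v\in T_{u_\xi}\Sigma_{\mu_\xi}\cap(T_{u_\xi}\mathcal O_{u_\xi})^\perp,\qquad D^2_{u_\xi}\mathcal L_\xi(v,v)\ge\delta\|v\|_E^2,$$ where $(T_{u_\xi}\mathcal O_{u_\xi})^\perp=\{v\in\hat E:\langle v,w\rangle=0\ \forall w\in T_{u_\xi}\mathcal O_{u_\xi}\}$.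
   Context: Symplectic setting. Let $E$ be a real Banach space with norm $\|\cdot\|_E$. A domain $\mathcal D$ is a dense subset of $E$. A symplector is an injective continuous linear map $\mathcal J:E\to E^*$ with $(\mathcal Ju)(v)=-(\mathcal Jv)(u)$; then $(E,\mathcal D,\mathcal J)$ is called a symplectic Banach triple. $\mathrm{Dif}(\mathcal D,\mathcal J)$ is the set of functions $H:E\to\mathbb R$ differentiable at each $u\in\mathcal D$ with $D_uH$ in the range of $\mathcal J$ for all $u\in\mathcal D$. A Hamiltonian flow for $H\in\mathrm{Dif}(\mathcal D,\mathcal J)$ is a separately continuous map $\Phi^H:\mathbb R\times E\to E$ such that $\Phi^H_{t+s}=\Phi^H_t\circ\Phi^H_s$, $\Phi^H_0=\mathrm{Id}$, $\Phi^H_t(\mathcal D)=\mathcal D$, and for $u\in\mathcal D$ the curve $u(t)=\Phi^H_t(u)$ is differentiable and is the unique solution of $\mathcal J\dot u(t)=D_{u(t)}H$, $u(0)=u$. Group action. $G$ is a connected matrix Lie group with Lie algebra $\mathfrak g$, $m=\dim\mathfrak g$, $\mathrm{Ad}_g\xi=g\xi g^{-1}$; $\mathfrak g$ and $\mathfrak g^*$ are identified with $\mathbb R^m$ and $\cdot$ is the canonical inner product of $\mathbb R^m$. An action $\Phi$ of $G$ on $E$ is globally Hamiltonian if: each $\Phi_g\in C^1(E,E)$ satisfies $(\mathcal JD_u\Phi_g v)(D_u\Phi_g w)=(\mathcal Jv)(w)$ for all $u\in\mathcal D$, $v,w\in E$; $\Phi_g(\mathcal D)=\mathcal D$; and for each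 $\xi\in\mathfrak g$ there is $F_\xi\in C^1(E,\mathbb R)\cap\mathrm{Dif}(\mathcal D,\mathcal J)$, linear in $\xi$, such that $\Phi_{\exp(t\xi)}=\Phi_t^{F_\xi}$ is a Hamiltonian flow. The momentum map is $F:E\to\mathbb R^m\simeq\mathfrak g^*$ with $F_\xi=\xi\cdot F$; it is $\mathrm{Ad}^*$-equivariant if $F_\xi\circ\Phi_g=F_{\mathrm{Ad}_{g^{-1}}\xi}$ for all $g,\xi$, i.e. $F\circ\Phi_g=\mathrm{Ad}^*_gF$. For $u\in\mathcal D$, $X_\eta(u)=\frac{d}{dt}\Phi_{\exp(t\eta)}(u)|_{t=0}$. For $\mu\in\mathfrak g^*$: $G_\mu=\{g\in G:\mathrm{Ad}^*_g\mu=\mu\}$ with Lie algebra $\mathfrak g_\mu$; $\Sigma_\mu=\{u\in E:F(u)=\mu\}$; $T_u\Sigma_\mu=\mathrm{Ker}\,D_uF$ for $u\in\Sigma_\mu$. For $u\in\mathcal D$ with $\mu=F(u)$: $\mathcal O_u=\Phi_{G_\mu}(u)$ and $T_u\mathcal O_u=\{X_\eta(u):\eta\in\mathfrak g_\mu\}$. Scalar product. A scalar product $\langle\cdot,\cdot\rangle$ on $E$ is continuous if $|\langle v,w\rangle|\le\|v\|_E\|w\|_E$. Put $\|v\|=\sqrt{\langle v,v\rangle}$ and let $\hat E\supset E$ be the completion (closure) of $E$ for $\|\cdot\|$, a Hilbert space. Hessians. $D^2_\xi W$ is the Hessian of $W$ at $\xi$, a symmetric bilinear form on $\mathbb R^m$;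 $p(D^2_\xi W)$ is the dimension of a maximal positive definite subspace of it. $n(D^2_u\mathcal L_\xi)$ is the Morse index: the dimension of a maximal negative definite subspace of $E$ for the symmetric bilinear form $D^2_u\mathcal L_\xi$. The kernel of a symmetric bilinear form $B$ on $E$ is $\{v\in E:B(v,w)=0\ \forall w\in E\}$. Under the inequality $D^2_u\mathcal L_\xi(v,v)\ge\varepsilon\|v\|_E^2-C\|v\|^2$, $\nabla^2\mathcal L_\xi(u)$ is the (generally unbounded) self-adjoint operator on $\hat E$ associated with the form $D^2_u\mathcal L_\xi$ by the First Representation Theorem: its domain is $\mathcal D(\nabla^2\mathcal L_\xi(u))=\{z\in E:\exists w\in\hat E,\ D^2_u\mathcal L_\xi(z,v)=\langle w,v\rangle\ \forall v\in E\}$ and $\nabla^2\mathcal L_\xi(u)z=w$. $\sigma$ denotes the spectrum. *)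

theory Defs
  imports "HOL-Analysis.Analysis"
begin

section \<open>Derivatives on Banach spaces\<close>

definition Fderiv :: "('a::real_normed_vector \<Rightarrow> 'b::real_normed_vector) \<Rightarrow> 'a \<Rightarrow> ('a \<Rightarrow>\<^sub>L 'b)"
  where "Fderiv f x = Blinfun (frechet_derivative f (at x))"

definition C1_on :: "'a::real_normed_vector set \<Rightarrow> ('a \<Rightarrow> 'b::real_normed_vector) \<Rightarrow> bool"
  where "C1_on S f \<longleftrightarrow> open S \<and> (\<forall>x\<in>S. f differentiable (at x)) \<and> continuous_on S (Fderiv f)"

definition C2_on :: "'a::real_normed_vector set \<Rightarrow> ('a \<Rightarrow> 'b::real_normed_vector) \<Rightarrow> bool"
  where "C2_on S f \<longleftrightarrow> C1_on S f \<and> C1_on S (Fderiv f)"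

definition Hess :: "('a::real_normed_vector \<Rightarrow> real) \<Rightarrow> 'a \<Rightarrow> 'a \<Rightarrow> 'a \<Rightarrow> real"
  where "Hess f x v w = blinfun_apply (blinfun_apply (Fderiv (Fderiv f) x) v) w"


section \<open>Symmetric bilinear forms\<close>

definition form_kernel :: "('a::real_vector \<Rightarrow> 'a \<Rightarrow> real) \<Rightarrow> 'a set"
  where "form_kernel B = {v. \<forall>w. B v w = 0}"

definition nondegenerate :: "('a::real_vector \<Rightarrow> 'a \<Rightarrow> real) \<Rightarrow> bool"
  where "nondegenerate B \<longleftrightarrow> form_kernel B = {0}"

text \<open>The library's \<open>dim\<close> is 0 for infinite-dimensional subspaces, hence an extended version.\<close>

definition edim :: "'a::real_vector set \<Rightarrow> enat"
  where "edim S = (if \<exists>b. finite b \<and> span b = S then enat (dim S) else \<infinity>)"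

definition pos_index :: "('a::real_vector \<Rightarrow> 'a \<Rightarrow> real) \<Rightarrow> enat"
  where "pos_index B = (SUP S\<in>{S. subspace S \<and> (\<forall>v\<in>S. v \<noteq> 0 \<longrightarrow> B v v > 0)}. edim S)"

definition neg_index :: "('a::real_vector \<Rightarrow> 'a \<Rightarrow> real) \<Rightarrow> enat"
  where "neg_index B = (SUP S\<in>{S. subspace S \<and> (\<forall>v\<in>S. v \<noteq> 0 \<longrightarrow> B v v < 0)}. edim S)"


section \<open>Scalar product, completion, and the operator associated with a form\<close>

definition continuous_scalar_product :: "('e::real_normed_vector \<Rightarrow> 'e \<Rightarrow> real) \<Rightarrow> bool"
  where "continuous_scalar_product ip \<longleftrightarrow>
    bilinear ip \<and> (\<forall>v w. ip v w = ip w v) \<and> (\<forall>v. v \<noteq> 0 \<longrightarrow> ip v v > 0) \<and>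
    (\<forall>v w. \<bar>ip v w\<bar> \<le> norm v * norm w)"

text \<open>The Hilbert space \<open>'h\<close>, together with the embedding \<open>\<iota>\<close>, is the completion of \<open>'e\<close> for
  the norm of \<open>ip\<close>; this determines it up to a unique isometric isomorphism. Elements and
  subspaces of \<open>'e\<close> are regarded as lying in \<open>'h\<close> through \<open>\<iota>\<close>.\<close>

definition is_completion ::
    "('e::real_normed_vector \<Rightarrow> 'e \<Rightarrow> real) \<Rightarrow> ('e \<Rightarrow> 'h::{real_inner, complete_space}) \<Rightarrow> bool"
  where "is_completion ip \<iota> \<longleftrightarrow>
    linear \<iota> \<and> (\<forall>v w. inner (\<iota> v) (\<iota> w) = ip v w) \<and> closure (range \<iota>) = UNIV"

definition op_dom :: "('e \<Rightarrow> 'h::real_inner) \<Rightarrow> ('e \<Rightarrow> 'e \<Rightarrow> real) \<Rightarrow> 'e set"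
  where "op_dom \<iota> B = {z. \<exists>w. \<forall>v. B z v = inner w (\<iota> v)}"

definition form_op :: "('e \<Rightarrow> 'h::real_inner) \<Rightarrow> ('e \<Rightarrow> 'e \<Rightarrow> real) \<Rightarrow> 'e \<Rightarrow> 'h"
  where "form_op \<iota> B z = (THE w. \<forall>v. B z v = inner w (\<iota> v))"

text \<open>Spectrum of an operator \<open>A\<close> on \<open>'h\<close> with domain \<open>\<iota> ` Z\<close>, as the complement of the set of
  those \<open>l\<close> for which \<open>A - l\<close> has an everywhere defined bounded inverse. Only real \<open>l\<close> are
  considered: \<open>'h\<close> is a real Hilbert space, and spectra of self-adjoint operators are real.\<close>

definition op_spectrum :: "('e \<Rightarrow> 'h::real_normed_vector) \<Rightarrow> 'e set \<Rightarrow> ('e \<Rightarrow> 'h) \<Rightarrow> real set"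
  where "op_spectrum \<iota> Z A =
    {l. \<not> (bij_betw (\<lambda>z. A z - l *\<^sub>R \<iota> z) Z UNIV \<and>
           (\<exists>K. \<forall>z\<in>Z. norm (\<iota> z) \<le> K * norm (A z - l *\<^sub>R \<iota> z)))}"


section \<open>Symplectic Banach triples and Hamiltonian flows\<close>

definition symplector :: "('e::banach \<Rightarrow> ('e \<Rightarrow>\<^sub>L real)) \<Rightarrow> bool"
  where "symplector J \<longleftrightarrow> bounded_linear J \<and> inj J \<and>
    (\<forall>u v. blinfun_apply (J u) v = - blinfun_apply (J v) u)"

definition symplectic_Banach_triple :: "'e::banach set \<Rightarrow> ('e \<Rightarrow> ('e \<Rightarrow>\<^sub>L real)) \<Rightarrow> bool"
  where "symplectic_Banach_triple D J \<longleftrightarrow> closure D = UNIV \<and> symplector J"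

definition Dif :: "'e::banach set \<Rightarrow> ('e \<Rightarrow> ('e \<Rightarrow>\<^sub>L real)) \<Rightarrow> ('e \<Rightarrow> real) set"
  where "Dif D J = {H. \<forall>u\<in>D. H differentiable (at u) \<and> Fderiv H u \<in> range J}"

text \<open>Solutions are curves in \<open>D\<close>, since \<open>H\<close> need not be differentiable elsewhere.\<close>

definition Hamiltonian_solution ::
    "'e::banach set \<Rightarrow> ('e \<Rightarrow> ('e \<Rightarrow>\<^sub>L real)) \<Rightarrow> ('e \<Rightarrow> real) \<Rightarrow> 'e \<Rightarrow> (real \<Rightarrow> 'e) \<Rightarrow> bool"
  where "Hamiltonian_solution D J H u c \<longleftrightarrow> c 0 = u \<and>
    (\<forall>t. c t \<in> D \<and> (\<exists>c'. (c has_vector_derivative c') (at t) \<and> J c' = Fderiv H (c t)))"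

definition Hamiltonian_flow ::
    "'e::banach set \<Rightarrow> ('e \<Rightarrow> ('e \<Rightarrow>\<^sub>L real)) \<Rightarrow> ('e \<Rightarrow> real) \<Rightarrow> (real \<Rightarrow> 'e \<Rightarrow> 'e) \<Rightarrow> bool"
  where "Hamiltonian_flow D J H \<phi> \<longleftrightarrow>
    H \<in> Dif D J \<and>
    (\<forall>u. continuous_on UNIV (\<lambda>t. \<phi> t u)) \<and> (\<forall>t. continuous_on UNIV (\<phi> t)) \<and>
    (\<forall>t s. \<phi> (t + s) = \<phi> t \<circ> \<phi> s) \<and> \<phi> 0 = id \<and> (\<forall>t. \<phi> t ` D = D) \<and>
    (\<forall>u\<in>D. Hamiltonian_solution D J H u (\<lambda>t. \<phi> t u) \<and>
      (\<forall>c. Hamiltonian_solution D J H u c \<longrightarrow> c = (\<lambda>t. \<phi> t u)))"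


section \<open>Matrix Lie groups\<close>

text \<open>The multiplication of the vector type is componentwise, so that the powers and the
  exponential of a matrix are defined here.\<close>

type_synonym 'n cmat = "complex^'n^'n"

definition mpow :: "'n::finite cmat \<Rightarrow> nat \<Rightarrow> 'n cmat"
  where "mpow A k = (((**) A) ^^ k) (mat 1)"

definition mexp :: "'n::finite cmat \<Rightarrow> 'n cmat"
  where "mexp A = (\<Sum>k. (1 / fact k) *\<^sub>R mpow A k)"

text \<open>Subgroups of the general linear group that are closed in it. Real matrix groups are a
  special case.\<close>

definition matrix_Lie_group :: "'n::finite cmat set \<Rightarrow> bool"
  where "matrix_Lie_group G \<longleftrightarrow>
    G \<subseteq> {A. invertible A} \<and> mat 1 \<in> G \<and>
    (\<forall>A\<in>G. \<forall>B\<in>G. A ** B \<in> G) \<and> (\<forall>A\<in>G. matrix_inv A \<in> G) \<and>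
    closedin (top_of_set {A. invertible A}) G"

definition Lie_algebra :: "'n::finite cmat set \<Rightarrow> 'n cmat set"
  where "Lie_algebra G = {X. \<forall>t::real. mexp (t *\<^sub>R X) \<in> G}"

text \<open>A linear isomorphism \<open>\<kappa>\<close> from \<open>real^'m\<close> onto the Lie algebra of \<open>G\<close> is the identification
  of the latter with m-dimensional space; its existence says that m is the dimension of the Lie
  algebra. The dual is identified with \<open>real^'m\<close> through the inner product.\<close>

definition Lie_algebra_coords :: "'n::finite cmat set \<Rightarrow> (real^'m::finite \<Rightarrow> 'n cmat) \<Rightarrow> bool"
  where "Lie_algebra_coords G \<kappa> \<longleftrightarrow> linear \<kappa> \<and> inj \<kappa> \<and> range \<kappa> = Lie_algebra G"

definition Ad :: "(real^'m::finite \<Rightarrow> 'n::finite cmat) \<Rightarrow> 'n cmat \<Rightarrow> real^'m \<Rightarrow> real^'m"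
  where "Ad \<kappa> g \<xi> = inv \<kappa> (g ** \<kappa> \<xi> ** matrix_inv g)"

definition Ad_star :: "(real^'m::finite \<Rightarrow> 'n::finite cmat) \<Rightarrow> 'n cmat \<Rightarrow> real^'m \<Rightarrow> real^'m"
  where "Ad_star \<kappa> g = adjoint (Ad \<kappa> (matrix_inv g))"

definition stabilizer ::
    "'n::finite cmat set \<Rightarrow> (real^'m::finite \<Rightarrow> 'n cmat) \<Rightarrow> real^'m \<Rightarrow> 'n cmat set"
  where "stabilizer G \<kappa> \<mu> = {g \<in> G. Ad_star \<kappa> g \<mu> = \<mu>}"


section \<open>Globally Hamiltonian actions\<close>

definition group_action :: "'n::finite cmat set \<Rightarrow> ('n cmat \<Rightarrow> 'e \<Rightarrow> 'e) \<Rightarrow> bool"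
  where "group_action G \<Phi> \<longleftrightarrow>
    \<Phi> (mat 1) = id \<and> (\<forall>g\<in>G. \<forall>h\<in>G. \<Phi> (g ** h) = \<Phi> g \<circ> \<Phi> h)"

text \<open>The family of functions \<open>F\<^sub>\<xi>\<close>, linear in \<open>\<xi>\<close>, is given by the momentum map \<open>F\<close> as
  \<open>F\<^sub>\<xi> = \<xi> \<bullet> F\<close>.\<close>

definition globally_Hamiltonian ::
    "'e::banach set \<Rightarrow> ('e \<Rightarrow> ('e \<Rightarrow>\<^sub>L real)) \<Rightarrow> 'n::finite cmat set \<Rightarrow> (real^'m::finite \<Rightarrow> 'n cmat) \<Rightarrow>
     ('n cmat \<Rightarrow> 'e \<Rightarrow> 'e) \<Rightarrow> ('e \<Rightarrow> real^'m) \<Rightarrow> bool"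
  where "globally_Hamiltonian D J G \<kappa> \<Phi> F \<longleftrightarrow>
    group_action G \<Phi> \<and>
    (\<forall>g\<in>G. C1_on UNIV (\<Phi> g) \<and> \<Phi> g ` D = D \<and>
      (\<forall>u\<in>D. \<forall>v w. blinfun_apply (J (blinfun_apply (Fderiv (\<Phi> g) u) v))
                       (blinfun_apply (Fderiv (\<Phi> g) u) w) = blinfun_apply (J v) w)) \<and>
    (\<forall>\<xi>. C1_on UNIV (\<lambda>u. inner \<xi> (F u)) \<and> (\<lambda>u. inner \<xi> (F u)) \<in> Dif D J \<and>
      Hamiltonian_flow D J (\<lambda>u. inner \<xi> (F u)) (\<lambda>t. \<Phi> (mexp (t *\<^sub>R \<kappa> \<xi>))))"

definition Ad_star_equivariant ::
    "'n::finite cmat set \<Rightarrow> (real^'m::finite \<Rightarrow> 'n cmat) \<Rightarrow> ('n cmat \<Rightarrow> 'e \<Rightarrow> 'e) \<Rightarrow> ('e \<Rightarrow> real^'m) \<Rightarrow> bool"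
  where "Ad_star_equivariant G \<kappa> \<Phi> F \<longleftrightarrow>
    (\<forall>g\<in>G. \<forall>\<xi> u. inner \<xi> (F (\<Phi> g u)) = inner (Ad \<kappa> (matrix_inv g) \<xi>) (F u))"

definition generator ::
    "(real^'m::finite \<Rightarrow> 'n::finite cmat) \<Rightarrow> ('n cmat \<Rightarrow> 'e::real_normed_vector \<Rightarrow> 'e) \<Rightarrow> real^'m \<Rightarrow> 'e \<Rightarrow> 'e"
  where "generator \<kappa> \<Phi> \<eta> u = vector_derivative (\<lambda>t. \<Phi> (mexp (t *\<^sub>R \<kappa> \<eta>)) u) (at 0)"

definition group_orbit ::
    "'n::finite cmat set \<Rightarrow> (real^'m::finite \<Rightarrow> 'n cmat) \<Rightarrow> ('n cmat \<Rightarrow> 'e \<Rightarrow> 'e) \<Rightarrow> ('e \<Rightarrow> real^'m) \<Rightarrow> 'e \<Rightarrow> 'e set"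
  where "group_orbit G \<kappa> \<Phi> F u = (\<lambda>g. \<Phi> g u) ` stabilizer G \<kappa> (F u)"

definition orbit_tangent ::
    "'n::finite cmat set \<Rightarrow> (real^'m::finite \<Rightarrow> 'n cmat) \<Rightarrow> ('n cmat \<Rightarrow> 'e::real_normed_vector \<Rightarrow> 'e) \<Rightarrow>
     ('e \<Rightarrow> real^'m) \<Rightarrow> 'e \<Rightarrow> 'e set"
  where "orbit_tangent G \<kappa> \<Phi> F u =
    {generator \<kappa> \<Phi> \<eta> u | \<eta>. \<kappa> \<eta> \<in> Lie_algebra (stabilizer G \<kappa> (F u))}"

text \<open>Tangent space at \<open>u\<close> to the level set of \<open>F\<close> through \<open>u\<close>.\<close>

definition level_tangent :: "('e::real_normed_vector \<Rightarrow> real^'m::finite) \<Rightarrow> 'e \<Rightarrow> 'e set"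
  where "level_tangent F u = {v. blinfun_apply (Fderiv F u) v = 0}"

definition orth_compl :: "('e \<Rightarrow> 'h::real_inner) \<Rightarrow> 'e set \<Rightarrow> 'h set"
  where "orth_compl \<iota> S = {x. \<forall>w\<in>S. inner x (\<iota> w) = 0}"

definition Lagr :: "('e \<Rightarrow> real) \<Rightarrow> ('e \<Rightarrow> real^'m::finite) \<Rightarrow> real^'m \<Rightarrow> 'e \<Rightarrow> real"
  where "Lagr H F \<xi> u = H u - inner \<xi> (F u)"

end

theory Submission
  imports Defs
begin

text \<open>Let \<open>B\<close> be the Hessian of the Lagrangian at \<open>u \<xi>\<close>, let \<open>D\<close> be the derivative of \<open>F\<close> at
  \<open>u \<xi>\<close>, whose kernel is the tangent space of the level set, and let \<open>U\<close> be the derivative of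
  \<open>\<eta> \<mapsto> u \<eta>\<close> at \<open>\<xi>\<close>. Differentiating the equation of relative equilibria gives
  \<open>B (U \<zeta>) v = \<zeta> \<bullet> D v\<close> (lemma \<open>Hess_Lagr_deriv_family\<close>), and differentiating \<open>W\<close> twice gives
  \<open>Hess W \<xi> \<zeta> \<theta> = - B (U \<zeta>) (U \<theta>)\<close> (lemma \<open>Hess_reduced_Lagr\<close>). Hence \<open>Ker D\<close> is the
  \<open>B\<close>-orthogonal complement of the range of \<open>U\<close>, and since \<open>Hess W \<xi>\<close> is non-degenerate the space is
  the direct sum of the two. The negative directions of \<open>B\<close> in the range of \<open>U\<close> are counted by the
  positive index of \<open>Hess W \<xi>\<close>; as this equals the Morse index of \<open>B\<close>, none are left for \<open>Ker D\<close>,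
  where \<open>B \<ge> 0\<close> (lemma \<open>nonneg_on_kernel_of_index\<close>).

  It remains to turn \<open>B \<ge> 0\<close> into coercivity orthogonally to \<open>Ker B\<close>, which by hypothesis is the
  tangent space of the orbit (lemma \<open>coercive_off_kernel\<close>). Let \<open>A\<close> be the operator of \<open>B\<close>, let
  \<open>(0, 2 l)\<close> be free of spectrum, \<open>S = (A - l)\<^sup>-\<^sup>1\<close> and \<open>T = A S = 1 + l S\<close>; the kernels of \<open>T\<close> and
  of \<open>B\<close> agree. The gap confines the spectrum of \<open>S\<close> to \<open>[-1/l, 1/l]\<close>, and for a symmetric
  operator this bounds its norm (lemma \<open>symmetric_norm_le_spectral_radius\<close>); thus \<open>T \<ge> 0\<close>. Moreover
  \<open>l B (S h) (S h) = \<parallel>T h\<parallel>\<^sup>2 - \<langle>T h, h\<rangle>\<close>, and \<open>S h \<in> Ker D\<close> if and only if \<open>T h\<close> is orthogonal to the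
  range of \<open>U\<close>. So \<open>\<langle>T h, h\<rangle> \<le> \<parallel>T h\<parallel>\<^sup>2\<close> under finitely many linear conditions on \<open>T h\<close>, and the
  Cauchy-Schwarz inequality for \<open>T\<close> shows that \<open>T\<close> is bounded below on \<open>(Ker T)\<^sup>\<bottom>\<close> (lemma
  \<open>symmetric_bounded_below_on_kernel_complement\<close>). This is where the finiteness of the index excludes
  spectrum accumulating at 0 from below.

  Finally let \<open>v \<in> Ker D\<close> be orthogonal to \<open>Ker B\<close>, and let \<open>y\<close> be the component of \<open>S (T v)\<close> in
  \<open>Ker D\<close>. Then \<open>\<parallel>T v\<parallel>\<^sup>2 = B v y\<close>, so that the Cauchy-Schwarz inequality for \<open>B\<close> on \<open>Ker D\<close> bounds
  \<open>\<parallel>T v\<parallel>\<^sup>2\<close>, and with it \<open>\<parallel>v\<parallel>\<^sup>2\<close>, by a multiple of \<open>B v v\<close>. The inequality assumed for \<open>B\<close> then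
  yields the bound in the norm of \<open>E\<close>.\<close>


section \<open>Derivatives\<close>

lemma has_derivative_Fderiv:
  assumes "f differentiable (at x)"
  shows "(f has_derivative blinfun_apply (Fderiv f x)) (at x)"
  using assms frechet_derivative_works has_derivative_bounded_linear
  by (metis Fderiv_def bounded_linear_Blinfun_apply)

lemma Fderiv_apply_eqI:
  assumes "(f has_derivative f') (at x)"
  shows "blinfun_apply (Fderiv f x) = f'"
  using assms frechet_derivative_at has_derivative_bounded_linear
  by (metis Fderiv_def bounded_linear_Blinfun_apply)

text \<open>The mean value theorem in direction \<open>w\<close>, applied to the increment
  \<open>f (\<cdot> + s v) - f\<close>, reduces the second difference to an increment of the first derivative. The
  estimate is not symmetric in \<open>v\<close> and \<open>w\<close>, whereas the second difference is; comparing the two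
  versions gives the symmetry of second derivatives.\<close>

lemma second_difference_estimate:
  fixes f :: "'a::real_normed_vector \<Rightarrow> real"
  assumes f: "\<And>y. (f has_derivative blinfun_apply (f' y)) (at y)"
    and f': "(f' has_derivative f'') (at x)"
    and e: "e > 0"
  shows "\<exists>d>0. \<forall>s. 0 < s \<and> s < d \<longrightarrow>
    \<bar>f (x + s *\<^sub>R v + s *\<^sub>R w) - f (x + s *\<^sub>R v) - f (x + s *\<^sub>R w) + f x
      - s\<^sup>2 * blinfun_apply (f'' v) w\<bar> \<le> e * s\<^sup>2"
proof -
  define N where "N = norm v + norm w + 1"
  have N: "N > 0" "norm v \<le> N" "norm w \<le> N" "norm v + norm w \<le> N" by (auto simp: N_def add_nonneg_pos)
  define e' where "e' = e / (2 * N * N)"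
  have e': "e' > 0" using e N by (simp add: e'_def)
  obtain d0 where d0: "d0 > 0"
    "\<And>y. norm (y - x) < d0 \<Longrightarrow> norm (f' y - f' x - f'' (y - x)) \<le> e' * norm (y - x)"
    using f' e' unfolding has_derivative_at_alt by blast
  interpret F2: bounded_linear f'' by (rule has_derivative_bounded_linear[OF f'])
  show ?thesis
  proof (intro exI[of _ "d0 / N"] conjI allI impI)
    show "d0 / N > 0" using d0 N by simp
    fix s :: real assume s: "0 < s \<and> s < d0 / N"
    then have sN: "s * N < d0" using N by (simp add: field_simps)
    define g where "g t = f (x + s *\<^sub>R v + (t * s) *\<^sub>R w) - f (x + (t * s) *\<^sub>R w)" for t :: real
    have g: "(g has_derivative (\<lambda>h. f' (x + s *\<^sub>R v + (t * s) *\<^sub>R w) ((h * s) *\<^sub>R w)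
        - f' (x + (t * s) *\<^sub>R w) ((h * s) *\<^sub>R w))) (at t)" for t
      unfolding g_def
      by (intro has_derivative_diff has_derivative_compose[OF _ f])
        (auto intro!: derivative_eq_intros)
    obtain t where t: "0 < t" "t < 1" and eq: "g 1 - g 0 =
        f' (x + s *\<^sub>R v + (t * s) *\<^sub>R w) (((1 - 0) * s) *\<^sub>R w)
        - f' (x + (t * s) *\<^sub>R w) (((1 - 0) * s) *\<^sub>R w)"
      using mvt_simple[of 0 1 g, OF _ has_derivative_at_withinI[OF g]] by auto
    define y1 where "y1 = x + s *\<^sub>R v + (t * s) *\<^sub>R w"
    define y2 where "y2 = x + (t * s) *\<^sub>R w"
    have "norm (y1 - x) \<le> s * norm v + (t * s) * norm w"
      unfolding y1_def using s t norm_triangle_ineq[of "s *\<^sub>R v" "(t * s) *\<^sub>R w"]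
      by (simp add: add.assoc)
    also have "\<dots> \<le> s * norm v + s * norm w"
      using s t by (intro add_left_mono mult_right_mono) auto
    also have "\<dots> \<le> s * N" using s N by (simp add: distrib_left[symmetric])
    finally have y1: "norm (y1 - x) \<le> s * N" .
    have "norm (y2 - x) = t * s * norm w" unfolding y2_def using s t by simp
    also have "\<dots> \<le> s * N" using s t N
      by (intro mult_mono) (auto intro: mult_left_le_one_le)
    finally have y2: "norm (y2 - x) \<le> s * N" .
    have r1: "norm (f' y1 - f' x - f'' (y1 - x)) \<le> e' * (s * N)"
      using d0(2)[of y1] y1 sN e' by (meson le_less_trans mult_left_mono less_imp_le order_trans)
    have r2: "norm (f' y2 - f' x - f'' (y2 - x)) \<le> e' * (s * N)"
      using d0(2)[of y2] y2 sN e' by (meson le_less_trans mult_left_mono less_imp_le order_trans)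
    define R where "R = (f' y1 - f' x - f'' (y1 - x)) - (f' y2 - f' x - f'' (y2 - x))"
    have nR: "norm R \<le> 2 * (e' * (s * N))"
      unfolding R_def using norm_triangle_ineq4 r1 r2 by (smt (verit))
    have "f'' (y1 - x) - f'' (y2 - x) = s *\<^sub>R f'' v"
      by (simp add: y1_def y2_def F2.scaleR F2.add)
    then have Req: "f' y1 - f' y2 = R + s *\<^sub>R f'' v" by (simp add: R_def algebra_simps)
    have "f (x + s *\<^sub>R v + s *\<^sub>R w) - f (x + s *\<^sub>R v) - f (x + s *\<^sub>R w) + f x = g 1 - g 0"
      by (simp add: g_def)
    also have "\<dots> = (f' y1 - f' y2) (s *\<^sub>R w)"
      unfolding eq y1_def y2_def by (simp add: blinfun.bilinear_simps right_diff_distrib)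
    also have "\<dots> = s * R w + s\<^sup>2 * f'' v w"
      unfolding Req by (simp add: blinfun.bilinear_simps power2_eq_square algebra_simps)
    finally have "\<bar>f (x + s *\<^sub>R v + s *\<^sub>R w) - f (x + s *\<^sub>R v) - f (x + s *\<^sub>R w) + f x
      - s\<^sup>2 * f'' v w\<bar> = s * \<bar>R w\<bar>" using s by (simp add: abs_mult)
    also have "\<dots> \<le> s * (2 * (e' * (s * N)) * N)"
    proof (rule mult_left_mono)
      have "\<bar>R w\<bar> \<le> norm R * norm w" using norm_blinfun[of R w] by simp
      also have "\<dots> \<le> 2 * (e' * (s * N)) * N"
        using nR N e' s by (intro mult_mono) auto
      finally show "\<bar>R w\<bar> \<le> 2 * (e' * (s * N)) * N" .
    qed (use s in simp)
    also have "\<dots> = e * s\<^sup>2" using N by (simp add: e'_def power2_eq_square)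
    finally show "\<bar>f (x + s *\<^sub>R v + s *\<^sub>R w) - f (x + s *\<^sub>R v) - f (x + s *\<^sub>R w) + f x
      - s\<^sup>2 * f'' v w\<bar> \<le> e * s\<^sup>2" .
  qed
qed

lemma second_derivative_symmetric:
  fixes f :: "'a::real_normed_vector \<Rightarrow> real"
  assumes f: "\<And>y. (f has_derivative blinfun_apply (f' y)) (at y)"
    and f': "(f' has_derivative f'') (at x)"
  shows "blinfun_apply (f'' v) w = blinfun_apply (f'' w) v"
proof -
  have "\<bar>f'' v w - f'' w v\<bar> \<le> e" if e: "e > 0" for e
  proof -
    obtain d1 where d1: "d1 > 0" "\<And>s. 0 < s \<and> s < d1 \<Longrightarrow>
      \<bar>f (x + s *\<^sub>R v + s *\<^sub>R w) - f (x + s *\<^sub>R v) - f (x + s *\<^sub>R w) + f x - s\<^sup>2 * f'' v w\<bar> \<le> (e/2) * s\<^sup>2"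
      using second_difference_estimate[OF f f', of "e/2" v w] e by auto
    obtain d2 where d2: "d2 > 0" "\<And>s. 0 < s \<and> s < d2 \<Longrightarrow>
      \<bar>f (x + s *\<^sub>R w + s *\<^sub>R v) - f (x + s *\<^sub>R w) - f (x + s *\<^sub>R v) + f x - s\<^sup>2 * f'' w v\<bar> \<le> (e/2) * s\<^sup>2"
      using second_difference_estimate[OF f f', of "e/2" w v] e by auto
    define s where "s = min d1 d2 / 2"
    have s: "0 < s" "s < d1" "s < d2" using d1(1) d2(1) by (auto simp: s_def)
    have comm: "x + s *\<^sub>R w + s *\<^sub>R v = x + s *\<^sub>R v + s *\<^sub>R w" by (simp add: add_ac)
    have "\<bar>s\<^sup>2 * f'' v w - s\<^sup>2 * f'' w v\<bar> \<le> e * s\<^sup>2"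
      using d1(2)[of s] d2(2)[of s] s unfolding comm abs_le_iff by linarith
    then have "s\<^sup>2 * \<bar>f'' v w - f'' w v\<bar> \<le> s\<^sup>2 * e"
      by (simp only: right_diff_distrib[symmetric] abs_mult mult.commute[of e]) simp
    then show ?thesis using s by simp
  qed
  then show ?thesis by (metis abs_le_zero_iff field_le_epsilon add_0 eq_iff_diff_eq_0)
qed

section \<open>Hilbert spaces\<close>

text \<open>A minimising sequence for the distance is Cauchy by the parallelogram law, so that
  completeness replaces local compactness.\<close>

lemma orthogonal_projection_exists:
  fixes S :: "'h::{real_inner, complete_space} set"
  assumes S: "subspace S" "closed S"
  shows "\<exists>s\<in>S. \<forall>y\<in>S. inner (x - s) y = 0"
proof -
  define d where "d = infdist x S"
  have ne: "S \<noteq> {}" using S subspace_0 by blast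
  have dle: "d \<le> norm (x - y)" if "y \<in> S" for y
    using infdist_le[OF that, of x] by (simp add: d_def dist_norm)
  have d0: "d \<ge> 0" by (simp add: d_def infdist_nonneg)
  have "\<exists>y\<in>S. norm (x - y) < d + 1 / real (Suc n)" for n
  proof -
    have "infdist x S < d + 1 / real (Suc n)" by (simp add: d_def)
    then have "(INF a\<in>S. dist x a) < d + 1 / real (Suc n)"
      using ne by (simp add: infdist_notempty)
    moreover have "bdd_below (dist x ` S)" by (rule bdd_belowI[of _ 0]) auto
    ultimately show ?thesis using ne by (auto simp: dist_norm cINF_less_iff)
  qed
  then obtain y where y: "\<And>n. y n \<in> S" "\<And>n. norm (x - y n) < d + 1 / real (Suc n)" by metis
  have para: "(norm (a - b))\<^sup>2 \<le> 2 * (norm (x - a))\<^sup>2 + 2 * (norm (x - b))\<^sup>2 - 4 * d\<^sup>2"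
    if "a \<in> S" "b \<in> S" for a b
  proof -
    have "(1/2) *\<^sub>R (a + b) \<in> S" using that S by (simp add: subspace_add subspace_scale)
    then have "d\<^sup>2 \<le> (norm (x - (1/2) *\<^sub>R (a + b)))\<^sup>2" using dle d0 by (intro power_mono) auto
    moreover have "(norm (a - b))\<^sup>2 + 4 * (norm (x - (1/2) *\<^sub>R (a + b)))\<^sup>2
        = 2 * (norm (x - a))\<^sup>2 + 2 * (norm (x - b))\<^sup>2"
      unfolding power2_norm_eq_inner
      by (simp add: inner_diff_left inner_diff_right inner_add_left inner_add_right inner_commute
          algebra_simps)
    ultimately show ?thesis by linarith
  qed
  have lim: "(\<lambda>n. norm (x - y n)) \<longlonglongrightarrow> d"
  proof (rule tendsto_sandwich[OF _ _ tendsto_const])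
    show "\<forall>\<^sub>F n in sequentially. d \<le> norm (x - y n)" using dle y by simp
    show "\<forall>\<^sub>F n in sequentially. norm (x - y n) \<le> d + 1 / real (Suc n)" 
      using y(2) by (simp add: less_imp_le)
    show "(\<lambda>n. d + 1 / real (Suc n)) \<longlonglongrightarrow> d"
      using tendsto_add[OF tendsto_const[of d] LIMSEQ_inverse_real_of_nat]
      by (simp add: divide_inverse)
  qed
  have "(\<lambda>n. (norm (x - y n))\<^sup>2 - d\<^sup>2) \<longlonglongrightarrow> 0"
    using tendsto_diff[OF tendsto_power[OF lim, of 2] tendsto_const[of "d\<^sup>2"]] by simp
  have "Cauchy y"
  proof (rule metric_CauchyI)
    fix e :: real assume e: "e > 0"
    then have "\<forall>\<^sub>F n in sequentially. (norm (x - y n))\<^sup>2 - d\<^sup>2 < e\<^sup>2 / 4"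
      using \<open>(\<lambda>n. (norm (x - y n))\<^sup>2 - d\<^sup>2) \<longlonglongrightarrow> 0\<close> by (intro order_tendstoD) auto
    then obtain N where N: "\<And>n. n \<ge> N \<Longrightarrow> (norm (x - y n))\<^sup>2 - d\<^sup>2 < e\<^sup>2 / 4"
      by (auto simp: eventually_sequentially)
    have "dist (y m) (y n) < e" if "m \<ge> N" "n \<ge> N" for m n
    proof -
      have "(norm (y m - y n))\<^sup>2 < e\<^sup>2"
        using para[OF y(1) y(1), of m n] N[OF that(1)] N[OF that(2)] by simp
      then show ?thesis using e by (simp add: dist_norm power2_less_imp_less)
    qed
    then show "\<exists>M. \<forall>m\<ge>M. \<forall>n\<ge>M. dist (y m) (y n) < e" by blast
  qed
  then obtain s where s: "y \<longlonglongrightarrow> s" by (auto simp: Cauchy_convergent_iff convergent_def)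
  have sS: "s \<in> S" using closed_sequentially[OF S(2)] y s by blast
  have "norm (x - s) = d"
    using LIMSEQ_unique[OF lim] tendsto_norm[OF tendsto_diff[OF tendsto_const s]] by metis
  have "inner (x - s) z = 0" if z: "z \<in> S" for z
  proof (cases "z = 0")
    case False
    define t where "t = inner (x - s) z / inner z z"
    have zz: "inner z z > 0" using False by simp
    have "s + t *\<^sub>R z \<in> S" using sS z S by (simp add: subspace_add subspace_scale)
    then have "d\<^sup>2 \<le> (norm (x - (s + t *\<^sub>R z)))\<^sup>2" using dle d0 by (intro power_mono) auto
    also have "\<dots> = (norm (x - s))\<^sup>2 - 2 * t * inner (x - s) z + t\<^sup>2 * inner z z"
      unfolding power2_norm_eq_inner diff_diff_eq[symmetric]
      by (simp add: inner_diff_left inner_diff_right inner_commute algebra_simps power2_eq_square)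
    also have "\<dots> = d\<^sup>2 - (inner (x - s) z)\<^sup>2 / inner z z"
      using \<open>norm (x - s) = d\<close> zz by (simp add: t_def power2_eq_square field_simps)
    finally have "(inner (x - s) z)\<^sup>2 / inner z z \<le> 0" by simp
    then show ?thesis using zz by (simp add: divide_le_0_iff)
  qed simp
  then show ?thesis using sS by blast
qed

lemma closure_of_subspace:
  fixes S :: "'a::real_normed_vector set"
  assumes "subspace S"
  shows "subspace (closure S)"
proof (rule subspaceI)
  show "0 \<in> closure S" using assms closure_subset subspace_0 by blast
  show "x + y \<in> closure S" if "x \<in> closure S" "y \<in> closure S" for x y
  proof -
    obtain a b where "\<forall>n. a n \<in> S" "a \<longlonglongrightarrow> x" "\<forall>n. b n \<in> S" "b \<longlonglongrightarrow> y"
      using \<open>x \<in> closure S\<close> \<open>y \<in> closure S\<close> unfolding closure_sequential by blast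
    then have "\<forall>n. a n + b n \<in> S" "(\<lambda>n. a n + b n) \<longlonglongrightarrow> x + y"
      using assms by (auto intro: subspace_add tendsto_add)
    then show ?thesis unfolding closure_sequential by (intro exI[of _ "\<lambda>n. a n + b n"] conjI)
  qed
  show "c *\<^sub>R x \<in> closure S" if "x \<in> closure S" for c x
  proof -
    obtain a where "\<forall>n. a n \<in> S" "a \<longlonglongrightarrow> x"
      using \<open>x \<in> closure S\<close> unfolding closure_sequential by blast
    then have "\<forall>n. c *\<^sub>R a n \<in> S" "(\<lambda>n. c *\<^sub>R a n) \<longlonglongrightarrow> c *\<^sub>R x"
      using assms by (auto intro: subspace_scale tendsto_scaleR)
    then show ?thesis unfolding closure_sequential by (intro exI[of _ "\<lambda>n. c *\<^sub>R a n"] conjI)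
  qed
qed

text \<open>The part of \<open>x\<close> orthogonal to the range of \<open>T\<close> lies in \<open>Ker T\<close> by symmetry. It is also orthogonal
  to \<open>Ker T\<close>, because \<open>x\<close> is and because \<open>closure (range T)\<close> is, so that it vanishes.\<close>

lemma closure_range_symmetric:
  fixes T :: "'h::{real_inner, complete_space} \<Rightarrow> 'h"
  assumes T: "bounded_linear T" and sym: "\<And>h k. inner (T h) k = inner h (T k)"
    and x: "\<And>k. T k = 0 \<Longrightarrow> inner x k = 0"
  shows "x \<in> closure (range T)"
proof -
  interpret T: bounded_linear T by (rule T)
  have sub: "subspace (range T)" using T.linear_axioms by (intro linear_subspace_image subspace_UNIV)
  obtain s where s: "s \<in> closure (range T)" "\<And>y. y \<in> closure (range T) \<Longrightarrow> inner (x - s) y = 0"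
    using orthogonal_projection_exists[OF closure_of_subspace[OF sub] closed_closure] by blast
  have "T (T (x - s)) \<in> closure (range T)" using closure_subset[of "range T"] by blast
  then have "inner (T (x - s)) (T (x - s)) = 0" unfolding sym by (rule s(2))
  then have "T (x - s) = 0" by simp
  moreover have ker: "inner s k = 0" if "T k = 0" for k
  proof -
    have "range T \<subseteq> {y. inner k y = 0}" using that sym by (auto simp: inner_commute[of k])
    then have "closure (range T) \<subseteq> {y. inner k y = 0}"
      by (rule closure_minimal) (rule closed_hyperplane)
    then show ?thesis using s(1) by (auto simp: inner_commute)
  qed
  ultimately have "inner (x - s) (x - s) = 0" using x by (simp add: inner_diff_left)
  then show ?thesis using s(1) by simp
qed

text \<open>A subspace keeps its density when finitely many orthogonality conditions are imposed: if some
  \<open>r \<in> R\<close> is not orthogonal to \<open>f\<close>, then subtracting a multiple of \<open>r\<close> moves an approximating sequence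
  into the hyperplane orthogonal to \<open>f\<close>, and that multiple tends to 0.\<close>

lemma closure_Int_orthogonal_finite:
  fixes R :: "'h::real_inner set"
  assumes "finite A" "subspace R" "x \<in> closure R" "\<And>a. a \<in> A \<Longrightarrow> inner x a = 0"
  shows "x \<in> closure (R \<inter> {y. \<forall>a\<in>A. inner y a = 0})"
  using assms
proof (induction A arbitrary: R rule: finite_induct)
  case (insert f A)
  define R1 where "R1 = R \<inter> {y. inner y f = 0}"
  have R1: "subspace R1"
    unfolding R1_def by (intro subspace_inter insert.prems subspace_hyperplane2)
  have "x \<in> closure R1"
  proof (cases "\<forall>r\<in>R. inner r f = 0")
    case True
    then have "R1 = R" by (auto simp: R1_def)
    then show ?thesis using insert.prems by simp
  next
    case False
    then obtain r where r: "r \<in> R" "inner r f \<noteq> 0" by blast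
    obtain y where y: "\<And>n. y n \<in> R" "y \<longlonglongrightarrow> x"
      using insert.prems(2) by (auto simp: closure_sequential)
    define z where "z n = y n - (inner (y n) f / inner r f) *\<^sub>R r" for n
    have "z n \<in> R1" for n
      using y r insert.prems(1) by (auto simp: R1_def z_def inner_diff_left subspace_diff subspace_scale)
    moreover have "z \<longlonglongrightarrow> x - (inner x f / inner r f) *\<^sub>R r"
      unfolding z_def using y r by (intro tendsto_intros) auto
    moreover have "inner x f = 0" using insert.prems by simp
    ultimately show ?thesis unfolding closure_sequential by auto
  qed
  then have "x \<in> closure (R1 \<inter> {y. \<forall>a\<in>A. inner y a = 0})"
    using insert R1 by blast
  moreover have "R1 \<inter> {y. \<forall>a\<in>A. inner y a = 0} = R \<inter> {y. \<forall>a\<in>insert f A. inner y a = 0}"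
    by (auto simp: R1_def)
  ultimately show ?case by simp
qed simp

text \<open>Passing from \<open>L \<inter> {f}\<^sup>\<bottom>\<close> to \<open>L\<close> adds at most one dimension, spanned by some \<open>e\<close>. The image of
  \<open>L \<inter> {f}\<^sup>\<bottom>\<close> is complete, hence closed, and by injectivity it does not contain \<open>T e\<close>: the two are
  at a positive distance, which controls the component along \<open>e\<close>.\<close>

lemma bounded_below_finite_codimension:
  fixes T :: "'h::{real_inner, complete_space} \<Rightarrow> 'k::real_normed_vector"
  assumes T: "bounded_linear T" and A: "finite A" and "subspace L" "closed L"
    and "\<And>x. x \<in> L \<Longrightarrow> T x = 0 \<Longrightarrow> x = 0"
    and "\<exists>c>0. \<forall>x\<in>L. (\<forall>a\<in>A. inner x a = 0) \<longrightarrow> c * norm x \<le> norm (T x)"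
  shows "\<exists>c>0. \<forall>x\<in>L. c * norm x \<le> norm (T x)"
  using A assms(3-)
proof (induction A arbitrary: L rule: finite_induct)
  case (insert f A)
  interpret T: bounded_linear T by (rule T)
  define L1 where "L1 = L \<inter> {y. inner y f = 0}"
  have sub1: "subspace L1"
    unfolding L1_def by (intro subspace_inter insert.prems subspace_hyperplane2)
  have "{y. inner y f = 0} = {y. inner f y = 0}" by (simp add: inner_commute)
  then have cl1: "closed L1"
    unfolding L1_def using closed_Int[OF insert.prems(2) closed_hyperplane] by metis
  have "\<exists>c>0. \<forall>x\<in>L1. (\<forall>a\<in>A. inner x a = 0) \<longrightarrow> c * norm x \<le> norm (T x)"
    using insert.prems(4) by (auto simp: L1_def)
  then obtain c where c: "c > 0" "\<And>x. x \<in> L1 \<Longrightarrow> c * norm x \<le> norm (T x)"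
    using insert.IH[OF sub1 cl1] insert.prems(3) by (auto simp: L1_def)
  show ?case
  proof (cases "L1 = L")
    case True
    then show ?thesis using c by auto
  next
    case False
    then obtain r where r: "r \<in> L" "inner r f \<noteq> 0" by (auto simp: L1_def)
    define e where "e = (1 / inner r f) *\<^sub>R r"
    have e: "e \<in> L" "inner e f = 1"
      using r insert.prems(1) by (auto simp: e_def subspace_scale)
    have "complete (T ` L1)"
      using complete_isometric_image[OF c(1) sub1 T] c(2) cl1 complete_eq_closed by blast
    then have clT: "closed (T ` L1)" by (rule complete_imp_closed)
    have "T e \<notin> T ` L1"
    proof
      assume "T e \<in> T ` L1"
      then obtain y where y: "y \<in> L1" "T e = T y" by auto
      then have "e - y \<in> L" "T (e - y) = 0"
        using insert.prems(1) e by (auto simp: L1_def T.diff subspace_diff)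
      then have "e - y = 0" by (rule insert.prems(3))
      then show False using y e by (auto simp: L1_def)
    qed
    moreover have "T ` L1 \<noteq> {}" using sub1 subspace_0 by blast
    ultimately have "infdist (T e) (T ` L1) > 0"
      using clT infdist_nonneg[of "T e"] in_closed_iff_infdist_zero by (metis less_eq_real_def)
    then obtain d where d: "d > 0" "\<And>y. y \<in> L1 \<Longrightarrow> d \<le> norm (T e - T y)"
      by (metis dist_norm imageI infdist_le)
    define c' where "c' = 1 / ((1 + norm (T e) / d) / c + norm e / d)"
    have pos: "(1 + norm (T e) / d) / c + norm e / d > 0"
      using c d by (intro add_pos_nonneg divide_pos_pos) (auto intro: add_pos_nonneg)
    have "c' * norm x \<le> norm (T x)" if x: "x \<in> L" for x
    proof -
      define a where "a = inner x f"
      define y where "y = x - a *\<^sub>R e"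
      have y: "y \<in> L1"
        using x e insert.prems(1) by (auto simp: L1_def y_def a_def inner_diff_left subspace_diff subspace_scale)
      have a: "\<bar>a\<bar> * d \<le> norm (T x)"
      proof (cases "a = 0")
        case False
        have "(- 1 / a) *\<^sub>R y \<in> L1" using y sub1 subspace_scale by blast
        then have "\<bar>a\<bar> * d \<le> \<bar>a\<bar> * norm (T e - T ((- 1 / a) *\<^sub>R y))" using d by (intro mult_left_mono) auto
        also have "\<dots> = norm (a *\<^sub>R (T e - T ((- 1 / a) *\<^sub>R y)))" by simp
        also have "a *\<^sub>R (T e - T ((- 1 / a) *\<^sub>R y)) = T x"
          using False by (simp add: y_def T.diff T.scaleR T.neg scaleR_diff_right)
        finally show ?thesis .
      qed simp
      then have a': "\<bar>a\<bar> \<le> norm (T x) / d" using d by (simp add: field_simps)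
      have "c * norm y \<le> norm (T x - a *\<^sub>R T e)"
        using c(2)[OF y] by (simp add: y_def T.diff T.scaleR)
      also have "\<dots> \<le> norm (T x) + \<bar>a\<bar> * norm (T e)"
        using norm_triangle_ineq4[of "T x" "a *\<^sub>R T e"] by simp
      also have "\<dots> \<le> norm (T x) + norm (T x) / d * norm (T e)"
        using a' by (intro add_left_mono mult_right_mono) auto
      finally have "norm y \<le> norm (T x) * ((1 + norm (T e) / d) / c)"
        using c by (simp add: field_simps)
      moreover have "norm x \<le> norm y + \<bar>a\<bar> * norm e"
        using norm_triangle_ineq[of y "a *\<^sub>R e"] by (simp add: y_def)
      moreover have "\<bar>a\<bar> * norm e \<le> norm (T x) / d * norm e"
        using a' by (intro mult_right_mono) auto
      ultimately have "norm x \<le> norm (T x) * ((1 + norm (T e) / d) / c + norm e / d)"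
        by (simp add: algebra_simps)
      then show ?thesis using pos by (simp add: c'_def field_simps)
    qed
    then show ?thesis using pos by (intro exI[of _ c']) (auto simp: c'_def)
  qed
qed simp


section \<open>Symmetric forms and symmetric bounded operators\<close>

lemma Cauchy_Schwarz_nonneg_form:
  fixes b :: "'a::real_vector \<Rightarrow> 'a \<Rightarrow> real"
  assumes b: "bilinear b" and sym: "\<And>x y. b x y = b y x"
    and Y: "subspace Y" "\<And>y. y \<in> Y \<Longrightarrow> b y y \<ge> 0" and xy: "x \<in> Y" "y \<in> Y"
  shows "(b x y)\<^sup>2 \<le> b x x * b y y"
proof -
  have q: "b x x + 2 * t * b x y + t\<^sup>2 * b y y \<ge> 0" for t
  proof -
    have "b (x + t *\<^sub>R y) (x + t *\<^sub>R y) = b x x + 2 * t * b x y + t\<^sup>2 * b y y"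
      by (simp add: bilinear_ladd[OF b] bilinear_radd[OF b] bilinear_lmul[OF b] bilinear_rmul[OF b]
          sym[of y x] power2_eq_square algebra_simps)
    then show ?thesis using Y xy by (metis subspace_add subspace_scale)
  qed
  have yy: "b y y \<ge> 0" using Y xy by simp
  show ?thesis
  proof (cases "b y y = 0")
    case True
    have "b x y = 0"
    proof (rule ccontr)
      assume "b x y \<noteq> 0"
      then show False using q[of "- (b x x + 1) / (2 * b x y)"] True by (simp add: field_simps)
    qed
    then show ?thesis using True by simp
  next
    case False
    with yy have "b y y > 0" by simp
    then show ?thesis
      using q[of "- b x y / b y y"] by (simp add: field_simps power2_eq_square)
  qed
qed

text \<open>The norm of a symmetric operator is its spectral radius. If \<open>M\<close> is the norm, then
  \<open>\<parallel>(S\<^sup>2 - M\<^sup>2) h\<parallel>\<^sup>2 \<le> M\<^sup>2 (M\<^sup>2 \<parallel>h\<parallel>\<^sup>2 - \<parallel>S h\<parallel>\<^sup>2)\<close>, which is small on almost maximising vectors, so that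
  \<open>S\<^sup>2 - M\<^sup>2 = (S - M) (S + M)\<close> is not bounded below.\<close>

lemma symmetric_norm_le_spectral_radius:
  fixes S :: "'h::real_inner \<Rightarrow> 'h"
  assumes S: "bounded_linear S" and sym: "\<And>h k. inner (S h) k = inner h (S k)" and r: "r \<ge> 0"
    and below: "\<And>s. \<bar>s\<bar> > r \<Longrightarrow> \<exists>c>0. \<forall>h. c * norm h \<le> norm (S h - s *\<^sub>R h)"
  shows "norm (S h) \<le> r * norm h"
proof -
  interpret S: bounded_linear S by (rule S)
  define M where "M = onorm S"
  have "M \<le> r"
  proof (rule ccontr)
    assume "\<not> M \<le> r"
    then have M: "M > r" "M > 0" using r by auto
    obtain c1 where c1: "c1 > 0" "\<And>h. c1 * norm h \<le> norm (S h - M *\<^sub>R h)"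
      using below[of M] M by auto
    obtain c2 where c2: "c2 > 0" "\<And>h. c2 * norm h \<le> norm (S h - (- M) *\<^sub>R h)"
      using below[of "- M"] M by auto
    define c where "c = c1 * c2"
    have c: "c > 0" using c1 c2 by (simp add: c_def)
    have low: "c * norm h \<le> norm (S (S h) - M\<^sup>2 *\<^sub>R h)" for h
    proof -
      have "c * norm h = c1 * (c2 * norm h)" by (simp add: c_def)
      also have "\<dots> \<le> c1 * norm (S h + M *\<^sub>R h)" using c1 c2(2)[of h] by (intro mult_left_mono) auto
      also have "\<dots> \<le> norm (S (S h + M *\<^sub>R h) - M *\<^sub>R (S h + M *\<^sub>R h))" by (rule c1)
      also have "S (S h + M *\<^sub>R h) - M *\<^sub>R (S h + M *\<^sub>R h) = S (S h) - M\<^sup>2 *\<^sub>R h"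
        by (simp add: S.add S.scaleR scaleR_add_right power2_eq_square)
      finally show ?thesis .
    qed
    define q where "q = max 0 (M\<^sup>2 - c\<^sup>2 / M\<^sup>2)"
    have "norm (S h) \<le> sqrt q * norm h" for h
    proof -
      have "(c * norm h)\<^sup>2 \<le> (norm (S (S h) - M\<^sup>2 *\<^sub>R h))\<^sup>2"
        using low c by (intro power_mono) auto
      also have "\<dots> = (norm (S (S h)))\<^sup>2 - 2 * M\<^sup>2 * (norm (S h))\<^sup>2 + (M\<^sup>2)\<^sup>2 * (norm h)\<^sup>2"
        unfolding power2_norm_eq_inner using sym[of "S h" h]
        by (simp add: inner_diff_left inner_diff_right inner_commute power2_eq_square)
      also have "(norm (S (S h)))\<^sup>2 \<le> (M * norm (S h))\<^sup>2"
        using onorm[OF S, of "S h"] by (intro power_mono) (auto simp: M_def)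
      finally have "M\<^sup>2 * (norm (S h))\<^sup>2 \<le> M\<^sup>2 * ((M\<^sup>2 - c\<^sup>2 / M\<^sup>2) * (norm h)\<^sup>2)"
        using M by (simp add: power_mult_distrib algebra_simps power2_eq_square)
      then have "(norm (S h))\<^sup>2 \<le> (M\<^sup>2 - c\<^sup>2 / M\<^sup>2) * (norm h)\<^sup>2" using M by simp
      also have "\<dots> \<le> q * (norm h)\<^sup>2" by (intro mult_right_mono) (auto simp: q_def)
      finally show ?thesis
        using real_le_rsqrt by (fastforce simp: real_sqrt_mult)
    qed
    then have "M \<le> sqrt q" unfolding M_def by (intro onorm_bound) (auto simp: q_def)
    then have "M\<^sup>2 \<le> q" using M by (metis q_def max.cobounded1 power_mono less_imp_le real_sqrt_pow2)
    moreover have "q < M\<^sup>2" using M c by (simp add: q_def)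
    ultimately show False by simp
  qed
  then show ?thesis using onorm[OF S, of h] mult_right_mono[of M r "norm h"] by (simp add: M_def)
qed

text \<open>With \<open>w = T h\<close> the Cauchy-Schwarz inequality for the form of \<open>T\<close> reads
  \<open>\<parallel>w\<parallel>\<^sup>4 \<le> \<langle>T h, h\<rangle> \<langle>T w, w\<rangle> \<le> \<parallel>w\<parallel>\<^sup>2 \<langle>T w, w\<rangle>\<close> whenever \<open>w\<close> is orthogonal to \<open>A\<close>. Hence
  \<open>\<langle>T w, w\<rangle> \<ge> \<parallel>w\<parallel>\<^sup>2\<close> on a dense part of a subspace of finite codimension in
  \<open>(Ker T)\<^sup>\<bottom>\<close>.\<close>

lemma symmetric_bounded_below_on_kernel_complement:
  fixes T :: "'h::{real_inner, complete_space} \<Rightarrow> 'h"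
  assumes T: "bounded_linear T" and sym: "\<And>h k. inner (T h) k = inner h (T k)"
    and nonneg: "\<And>h. inner (T h) h \<ge> 0"
    and A: "finite A" "\<And>h. (\<And>a. a \<in> A \<Longrightarrow> inner (T h) a = 0) \<Longrightarrow> inner (T h) h \<le> (norm (T h))\<^sup>2"
  shows "\<exists>c>0. \<forall>x. (\<forall>k. T k = 0 \<longrightarrow> inner x k = 0) \<longrightarrow> c * norm x \<le> norm (T x)"
proof -
  interpret T: bounded_linear T by (rule T)
  define R where "R = range T"
  define P where "P = {y. \<forall>a\<in>A. inner y a = 0}"
  have sub: "subspace R"
    unfolding R_def using T.linear_axioms by (intro linear_subspace_image subspace_UNIV)
  have bil: "bilinear (\<lambda>x y. inner (T x) y)"
    unfolding bilinear_def by (auto intro!: linearI simp: T.add T.scaleR inner_add_left inner_add_right)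
  have "norm w \<le> norm (T w)" if w: "w \<in> R \<inter> P" for w
  proof -
    obtain h where h: "w = T h" using w by (auto simp: R_def)
    have sym': "inner (T x) y = inner (T y) x" for x y using sym[of x y] inner_commute by metis
    have "(inner (T h) w)\<^sup>2 \<le> inner (T h) h * inner (T w) w"
      using Cauchy_Schwarz_nonneg_form[OF bil sym' subspace_UNIV] nonneg by blast
    also have "\<dots> \<le> (norm w)\<^sup>2 * inner (T w) w"
      using A(2)[of h] w h by (intro mult_right_mono nonneg) (auto simp: P_def)
    also have "\<dots> \<le> (norm w)\<^sup>2 * (norm (T w) * norm w)"
      by (intro mult_left_mono norm_cauchy_schwarz) auto
    finally have "norm w ^ 3 * norm w \<le> norm w ^ 3 * norm (T w)"
      by (simp add: h[symmetric] power2_norm_eq_inner[symmetric] power2_eq_square power3_eq_cube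
          mult_ac)
    then show ?thesis by (cases "w = 0") auto
  qed
  then have "closure (R \<inter> P) \<subseteq> {w. norm w \<le> norm (T w)}"
    by (intro closure_minimal closed_Collect_le continuous_on_norm T.continuous_on continuous_on_id) auto
  then have below: "norm x \<le> norm (T x)" if "x \<in> closure R" "\<And>a. a \<in> A \<Longrightarrow> inner x a = 0" for x
    using closure_Int_orthogonal_finite[OF A(1) sub that(1)] that(2) by (auto simp: P_def)
  have "x = 0" if "x \<in> closure R" "T x = 0" for x
  proof -
    have "R \<subseteq> {y. inner x y = 0}" using that sym by (auto simp: R_def inner_commute[of x])
    then have "closure R \<subseteq> {y. inner x y = 0}"
      by (rule closure_minimal) (rule closed_hyperplane)
    then show ?thesis using that by auto
  qed
  then obtain c where "c > 0" "\<And>x. x \<in> closure R \<Longrightarrow> c * norm x \<le> norm (T x)"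
    using bounded_below_finite_codimension[OF T A(1) closure_of_subspace[OF sub] closed_closure]
      below by (metis mult_1 zero_less_one)
  then show ?thesis
    using closure_range_symmetric[OF T sym] unfolding R_def by blast
qed


section \<open>Resolvents of the operator of a form\<close>

lemma completion_inner_eqI:
  assumes "is_completion ip \<iota>" and "\<And>v. inner w (\<iota> v) = inner w' (\<iota> v)"
  shows "w = w'"
proof -
  have "range \<iota> \<subseteq> {y. inner (w - w') y = 0}" using assms(2) by (auto simp: inner_diff_left)
  then have "closure (range \<iota>) \<subseteq> {y. inner (w - w') y = 0}"
    by (rule closure_minimal) (rule closed_hyperplane)
  then have "w - w' \<in> {y. inner (w - w') y = 0}" using assms(1) unfolding is_completion_def by blast
  then show ?thesis by simp
qed

lemma form_op_eqI:
  assumes "is_completion ip \<iota>" and "\<And>v. B z v = inner w (\<iota> v)"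
  shows "form_op \<iota> B z = w"
  unfolding form_op_def
  by (rule the_equality) (use assms completion_inner_eqI[OF assms(1)] in auto)

text \<open>The resolvent is described through the form alone: \<open>z = R h\<close> is the solution of
  \<open>B z v = \<langle>h + l z, v\<rangle>\<close> for all \<open>v\<close>. It takes values in the form domain, rather than in its
  completion, so that \<open>B\<close> can be evaluated on them.\<close>

lemma form_op_resolvent:
  fixes B :: "'e::real_normed_vector \<Rightarrow> 'e \<Rightarrow> real" and \<iota> :: "'e \<Rightarrow> 'h::{real_inner, complete_space}"
  assumes B: "bilinear B" and compl: "is_completion ip \<iota>"
    and l: "l \<notin> op_spectrum \<iota> (op_dom \<iota> B) (form_op \<iota> B)"
  obtains R K where "linear R" "\<And>h v. B (R h) v = inner (h + l *\<^sub>R \<iota> (R h)) (\<iota> v)"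
    "\<And>z h. (\<And>v. B z v = inner (h + l *\<^sub>R \<iota> z) (\<iota> v)) \<Longrightarrow> R h = z"
    "K > 0" "\<And>h. norm (\<iota> (R h)) \<le> K * norm h"
proof -
  have \<iota>: "linear \<iota>" using compl by (simp add: is_completion_def)
  let ?Z = "op_dom \<iota> B" and ?A = "\<lambda>z. form_op \<iota> B z - l *\<^sub>R \<iota> z"
  have bij: "bij_betw ?A ?Z UNIV" and "\<exists>K. \<forall>z\<in>?Z. norm (\<iota> z) \<le> K * norm (?A z)"
    using l by (auto simp: op_spectrum_def)
  then obtain K0 where K0: "\<And>z. z \<in> ?Z \<Longrightarrow> norm (\<iota> z) \<le> K0 * norm (?A z)" by blast
  define R where "R = inv_into ?Z ?A"
  have char: "z \<in> ?Z \<and> ?A z = h" if "\<And>v. B z v = inner (h + l *\<^sub>R \<iota> z) (\<iota> v)" for z h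
    using form_op_eqI[where B = B and z = z, OF compl that] that by (auto simp: op_dom_def)
  have R: "R h \<in> ?Z" "?A (R h) = h" for h
    using bij_betw_inv_into_right[OF bij, of h] bij_betw_apply[OF bij_betw_inv_into[OF bij], of h]
    by (auto simp: R_def)
  have eq: "B (R h) v = inner (h + l *\<^sub>R \<iota> (R h)) (\<iota> v)" for h v
  proof -
    obtain w where w: "\<And>v. B (R h) v = inner w (\<iota> v)" using R(1)[of h] by (auto simp: op_dom_def)
    then have "w = h + l *\<^sub>R \<iota> (R h)"
      using form_op_eqI[where B = B and z = "R h", OF compl w] R(2)[of h] by (simp add: algebra_simps)
    then show ?thesis using w by simp
  qed
  have uniq: "R h = z" if "\<And>v. B z v = inner (h + l *\<^sub>R \<iota> z) (\<iota> v)" for z h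
    using char[OF that] bij_betw_inv_into_left[OF bij, of z] by (auto simp: R_def)
  show ?thesis
  proof (rule that[of R "\<bar>K0\<bar> + 1"])
    show "linear R"
    proof (rule linearI)
      show "R (h + k) = R h + R k" for h k
        by (rule uniq) (simp add: bilinear_ladd[OF B] eq linear_add[OF \<iota>] inner_add_left algebra_simps)
      show "R (c *\<^sub>R h) = c *\<^sub>R R h" for c h
        by (rule uniq) (simp add: bilinear_lmul[OF B] eq linear_scale[OF \<iota>] inner_add_left algebra_simps)
    qed
    show "norm (\<iota> (R h)) \<le> (\<bar>K0\<bar> + 1) * norm h" for h
    proof -
      have "norm (\<iota> (R h)) \<le> K0 * norm h" using K0[OF R(1)] R(2) by metis
      also have "\<dots> \<le> (\<bar>K0\<bar> + 1) * norm h" by (intro mult_right_mono) auto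
      finally show ?thesis .
    qed
  qed (use eq uniq in auto)
qed


section \<open>Coercivity on the constrained subspace\<close>

text \<open>\<open>U\<close> and \<open>D\<close> are dual to each other with respect to \<open>B\<close>, so that \<open>Ker D\<close> is the
  \<open>B\<close>-orthogonal complement of the range of \<open>U\<close>, and by \<open>nondeg\<close> a complement in the linear sense as
  well. The operators \<open>S\<close> and \<open>T\<close> in the proof are \<open>(A - l)\<^sup>-\<^sup>1\<close> and \<open>A (A - l)\<^sup>-\<^sup>1\<close> for the
  operator \<open>A\<close> of the form; they are bounded, which avoids the calculus of unbounded operators.
  The gap makes \<open>T\<close> nonnegative, and positivity of \<open>B\<close> on \<open>Ker D\<close> makes
  \<open>\<langle>T h, h\<rangle> \<le> \<parallel>T h\<parallel>\<^sup>2\<close> whenever \<open>T h\<close> is orthogonal to the range of \<open>U\<close>, a condition of finite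
  codimension. So \<open>T\<close> is bounded below off its kernel, which is also that of \<open>B\<close>.\<close>

lemma coercive_off_kernel:
  fixes B :: "'e::real_normed_vector \<Rightarrow> 'e \<Rightarrow> real"
    and \<iota> :: "'e \<Rightarrow> 'h::{real_inner, complete_space}"
    and U :: "'m::euclidean_space \<Rightarrow> 'e" and D :: "'e \<Rightarrow> 'm"
  assumes B: "bounded_bilinear B" and sym: "\<And>v w. B v w = B w v"
    and compl: "is_completion ip \<iota>"
    and \<epsilon>: "\<epsilon> > 0" "C > 0" and garding: "\<And>v. B v v \<ge> \<epsilon> * (norm v)\<^sup>2 - C * ip v v"
    and \<gamma>: "\<gamma> > 0" and gap: "\<And>l. 0 < l \<Longrightarrow> l < \<gamma> \<Longrightarrow> l \<notin> op_spectrum \<iota> (op_dom \<iota> B) (form_op \<iota> B)"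
    and U: "linear U" and D: "bounded_linear D" and UD: "\<And>z v. B (U z) v = inner z (D v)"
    and nondeg: "\<And>z. D (U z) = 0 \<Longrightarrow> z = 0"
    and nonneg: "\<And>v. D v = 0 \<Longrightarrow> B v v \<ge> 0"
  shows "\<exists>\<delta>>0. \<forall>v. D v = 0 \<and> (\<forall>w\<in>form_kernel B. inner (\<iota> v) (\<iota> w) = 0) \<longrightarrow> \<delta> * (norm v)\<^sup>2 \<le> B v v"
proof -
  interpret B: bounded_bilinear B by (rule B)
  interpret D: bounded_linear D by (rule D)
  have bil: "bilinear B" using B by (simp add: bilinear_conv_bounded_bilinear bilinear_def
        bounded_linear.linear B.bounded_linear_left B.bounded_linear_right)
  have \<iota>: "linear \<iota>" and ip: "ip v w = inner (\<iota> v) (\<iota> w)" for v w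
    using compl by (auto simp: is_completion_def)
  \<comment> \<open>the midpoint, at distance \<open>l\<close> from both ends of the gap; this distance enters as \<open>\<parallel>S\<parallel> \<le> 1/l\<close>\<close>
  define l where "l = \<gamma> / 2"
  have l: "l > 0" "\<gamma> = 2 * l" using \<gamma> by (auto simp: l_def)
  obtain R K where R: "linear R" "\<And>h v. B (R h) v = inner (h + l *\<^sub>R \<iota> (R h)) (\<iota> v)"
    and K: "K > 0" "\<And>h. norm (\<iota> (R h)) \<le> K * norm h"
    using form_op_resolvent[OF bil compl gap[of l]] l by auto metis
  define S where "S h = \<iota> (R h)" for h
  define T where "T h = h + l *\<^sub>R S h" for h
  have BR: "B (R h) v = inner (T h) (\<iota> v)" for h v by (simp add: R T_def S_def)
  have S: "bounded_linear S"
    using K linear_compose[OF R(1) \<iota>] unfolding S_def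
    by (intro bounded_linear_intro[where K = K])
      (auto simp: linear_add linear_scale linear_add[OF R(1)] linear_add[OF \<iota>] linear_scale[OF R(1)]
        linear_scale[OF \<iota>] mult.commute)
  have symS: "inner (S h) k = inner h (S k)" for h k
    using sym[of "R k" "R h"] unfolding R(2)
    by (simp add: S_def inner_add_left inner_commute[of "\<iota> (R h)" "\<iota> (R k)"] inner_commute[of k])
  \<comment> \<open>for \<open>|s| > 1/l\<close> the point \<open>l + 1/s\<close> lies in the gap, so that \<open>S - s\<close> is bounded below\<close>
  have normS: "norm (S h) \<le> 1 / l * norm h" for h
  proof (rule symmetric_norm_le_spectral_radius[OF S symS])
    show "1 / l \<ge> 0" using l by simp
    fix s :: real assume s: "\<bar>s\<bar> > 1 / l"
    then have s0: "s \<noteq> 0" using l by auto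
    have "\<bar>1 / s\<bar> < l" using s s0 l by (simp add: field_simps)
    then have "0 < l + 1 / s" "l + 1 / s < \<gamma>" unfolding abs_less_iff using l by linarith+
    then obtain R' K' where R': "\<And>z h. (\<And>v. B z v = inner (h + (l + 1/s) *\<^sub>R \<iota> z) (\<iota> v)) \<Longrightarrow> R' h = z"
      and K': "K' > 0" "\<And>h. norm (\<iota> (R' h)) \<le> K' * norm h"
      using form_op_resolvent[OF bil compl gap[of "l + 1/s"]] by metis
    have eq: "R' ((- 1 / s) *\<^sub>R (S h - s *\<^sub>R h)) = R h" for h
      by (rule R') (use s0 in \<open>simp add: R S_def algebra_simps\<close>)
    have "\<bar>s\<bar> / (1 + K' / \<bar>s\<bar>) * norm h \<le> norm (S h - s *\<^sub>R h)" for h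
    proof -
      have "norm (S h) \<le> K' / \<bar>s\<bar> * norm (S h - s *\<^sub>R h)"
        using K'(2)[of "(- 1 / s) *\<^sub>R (S h - s *\<^sub>R h)"] unfolding eq by (simp add: S_def)
      moreover have "\<bar>s\<bar> * norm h \<le> norm (S h) + norm (S h - s *\<^sub>R h)"
        using norm_triangle_ineq4[of "S h" "S h - s *\<^sub>R h"] by simp
      ultimately have "\<bar>s\<bar> * norm h \<le> (1 + K' / \<bar>s\<bar>) * norm (S h - s *\<^sub>R h)"
        by (simp add: algebra_simps)
      moreover have "1 + K' / \<bar>s\<bar> > 0" using K' by (intro add_pos_nonneg) auto
      ultimately show ?thesis by (simp add: field_simps)
    qed
    moreover have "\<bar>s\<bar> / (1 + K' / \<bar>s\<bar>) > 0"
      using K' s0 by (intro divide_pos_pos add_pos_nonneg) auto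
    ultimately show "\<exists>c>0. \<forall>h. c * norm h \<le> norm (S h - s *\<^sub>R h)" by blast
  qed
  have T: "bounded_linear T"
    unfolding T_def by (intro bounded_linear_add bounded_linear_ident bounded_linear_const_scaleR S)
  have symT: "inner (T h) k = inner h (T k)" for h k
    by (simp add: T_def inner_add_left inner_add_right symS)
  have nonnegT: "inner (T h) h \<ge> 0" for h
  proof -
    have "\<bar>inner (S h) h\<bar> \<le> norm (S h) * norm h" by (rule Cauchy_Schwarz_ineq2)
    also have "\<dots> \<le> 1 / l * norm h * norm h" by (intro mult_right_mono normS) auto
    finally have "l * \<bar>inner (S h) h\<bar> \<le> inner h h"
      using l by (simp add: field_simps power2_norm_eq_inner[symmetric] power2_eq_square)
    then have "- (l * inner (S h) h) \<le> inner h h" using l by (smt (verit) mult_minus_right mult_left_mono)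
    then show ?thesis by (simp add: T_def inner_add_left)
  qed
  obtain c where c: "c > 0" "\<And>x. (\<And>k. T k = 0 \<Longrightarrow> inner x k = 0) \<Longrightarrow> c * norm x \<le> norm (T x)"
  proof -
    have "inner (T h) h \<le> (norm (T h))\<^sup>2" if h: "\<And>a. a \<in> (\<lambda>b. \<iota> (U b)) ` Basis \<Longrightarrow> inner (T h) a = 0" for h
    proof -
      have "inner b (D (R h)) = 0" if "b \<in> Basis" for b
        using h[of "\<iota> (U b)"] that by (simp add: BR[symmetric] sym[of _ "U b"] UD)
      then have "D (R h) = 0" using euclidean_all_zero_iff by (metis inner_commute)
      then have "0 \<le> l * inner (T h) (S h)" using nonneg[of "R h"] l by (simp add: BR S_def)
      also have "\<dots> = inner (T h) (T h - h)" by (simp add: T_def)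
      finally show ?thesis by (simp add: inner_diff_right power2_norm_eq_inner)
    qed
    then show ?thesis
      using symmetric_bounded_below_on_kernel_complement[OF T symT nonnegT, of "(\<lambda>b. \<iota> (U b)) ` Basis"]
        that by auto
  qed
  obtain M1 where M1: "M1 > 0" "\<And>h. (norm (R h))\<^sup>2 \<le> M1 * (norm h)\<^sup>2"
  proof
    show "((1 + l * K) * K + C * K\<^sup>2) / \<epsilon> > 0" using \<epsilon> K l by (auto intro!: divide_pos_pos add_pos_pos mult_pos_pos)
    show "(norm (R h))\<^sup>2 \<le> ((1 + l * K) * K + C * K\<^sup>2) / \<epsilon> * (norm h)\<^sup>2" for h
    proof -
      have SK: "norm (S h) \<le> K * norm h" using K by (simp add: S_def)
      have "norm (T h) \<le> norm h + l * norm (S h)"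
        unfolding T_def using norm_triangle_ineq[of h "l *\<^sub>R S h"] l by simp
      also have "\<dots> \<le> norm h + l * (K * norm h)" using SK l by simp
      finally have TK: "norm (T h) \<le> (1 + l * K) * norm h" by (simp add: algebra_simps)
      have "\<epsilon> * (norm (R h))\<^sup>2 \<le> B (R h) (R h) + C * (norm (S h))\<^sup>2"
        using garding[of "R h"] by (simp add: ip S_def power2_norm_eq_inner)
      also have "\<dots> \<le> norm (T h) * norm (S h) + C * (norm (S h))\<^sup>2"
        unfolding BR S_def by (intro add_right_mono norm_cauchy_schwarz)
      also have "\<dots> \<le> ((1 + l * K) * norm h) * (K * norm h) + C * (K * norm h)\<^sup>2"
        using TK SK \<epsilon> K l by (intro add_mono mult_mono power_mono) auto
      also have "\<dots> = ((1 + l * K) * K + C * K\<^sup>2) * (norm h)\<^sup>2"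
        by (simp add: power2_eq_square algebra_simps)
      finally show ?thesis using \<epsilon> by (simp add: field_simps)
    qed
  qed
  \<comment> \<open>\<open>y - P y\<close> is the part of \<open>y\<close> in the range of \<open>U\<close>, which is \<open>B\<close>-orthogonal to \<open>Ker D\<close>\<close>
  obtain P M2 where P: "\<And>y. D (P y) = 0" "\<And>y v. D v = 0 \<Longrightarrow> B v y = B v (P y)"
    and M2: "M2 > 0" "\<And>y. B (P y) (P y) \<le> M2 * (norm y)\<^sup>2"
  proof -
    have lin: "linear (\<lambda>z. D (U z))" using linear_compose[OF U D.linear_axioms] by (simp add: o_def)
    have "inj (\<lambda>z. D (U z))" using linear_injective_0[OF lin] nondeg by blast
    then obtain N where N: "linear N" "\<And>z. D (U (N z)) = z"
      using linear_injective_isomorphism[OF lin] by blast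
    define P where "P y = y - U (N (D y))" for y
    have bl: "bounded_linear P"
    proof -
      have "bounded_linear (\<lambda>z. U (N z))"
        using linear_compose[OF N(1) U] by (simp add: o_def linear_conv_bounded_linear)
      then show ?thesis unfolding P_def
        by (intro bounded_linear_sub bounded_linear_ident bounded_linear_compose[OF _ D])
    qed
    obtain KB where KB: "KB > 0" "\<And>a b. norm (B a b) \<le> norm a * norm b * KB"
      using B.pos_bounded by blast
    obtain KP where KP: "KP > 0" "\<And>y. norm (P y) \<le> norm y * KP"
      using bounded_linear.pos_bounded[OF bl] by blast
    show ?thesis
    proof (rule that[of P "KP * KP * KB"])
      show "D (P y) = 0" for y by (simp add: P_def D.diff N)
      show "B v y = B v (P y)" if "D v = 0" for v y
        using that by (simp add: P_def B.diff_right sym[of v "U _"] UD)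
      show "KP * KP * KB > 0" using KP KB by simp
      show "B (P y) (P y) \<le> KP * KP * KB * (norm y)\<^sup>2" for y
      proof -
        have "B (P y) (P y) \<le> norm (P y) * norm (P y) * KB" using KB(2)[of "P y" "P y"] by simp
        also have "\<dots> \<le> (norm y * KP) * (norm y * KP) * KB"
          using KP KB by (intro mult_right_mono mult_mono) auto
        finally show ?thesis by (simp add: power2_eq_square mult_ac)
      qed
    qed
  qed
  define \<delta> where "\<delta> = \<epsilon> / (1 + C * (M2 * M1) / c\<^sup>2)"
  have pos: "1 + C * (M2 * M1) / c\<^sup>2 > 0" using \<epsilon> M1 M2 c by (intro add_pos_pos) auto
  have "\<delta> * (norm v)\<^sup>2 \<le> B v v"
    if v: "D v = 0" "\<And>w. w \<in> form_kernel B \<Longrightarrow> inner (\<iota> v) (\<iota> w) = 0" for v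
  proof -
    have "inner (\<iota> v) k = 0" if "T k = 0" for k
    proof -
      have "R k \<in> form_kernel B" using that by (simp add: form_kernel_def BR)
      then have "inner (\<iota> v) (S k) = 0" using v by (simp add: S_def)
      moreover have "k = (- l) *\<^sub>R S k" using that by (simp add: T_def eq_neg_iff_add_eq_0)
      ultimately show ?thesis by (metis inner_scaleR_right mult_zero_right)
    qed
    then have low: "c * norm (\<iota> v) \<le> norm (T (\<iota> v))" by (rule c)
    \<comment> \<open>\<open>B (v, R (T v)) = \<parallel>T v\<parallel>\<^sup>2\<close>, and the second argument has norm \<open>O(\<parallel>T v\<parallel>)\<close>\<close>
    define t where "t = (norm (T (\<iota> v)))\<^sup>2"
    define y where "y = P (R (T (\<iota> v)))"
    have t: "t = B v y"
      using BR[of "T (\<iota> v)" v] sym[of v "R (T (\<iota> v))"] P(2)[OF v(1)]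
      by (simp add: t_def y_def symT power2_norm_eq_inner)
    have subD: "subspace {v. D v = 0}" by (rule linear_subspace_kernel) (rule D.linear_axioms)
    have "t\<^sup>2 \<le> B v v * B y y"
      unfolding t using Cauchy_Schwarz_nonneg_form[OF bil sym subD] nonneg v(1) P(1)
      by (simp add: y_def)
    also have "\<dots> \<le> B v v * (M2 * M1 * t)"
    proof (rule mult_left_mono)
      have "B y y \<le> M2 * (norm (R (T (\<iota> v))))\<^sup>2" unfolding y_def by (rule M2)
      also have "\<dots> \<le> M2 * (M1 * t)" unfolding t_def using M2 M1 by (intro mult_left_mono) auto
      finally show "B y y \<le> M2 * M1 * t" by simp
    qed (use nonneg v in simp)
    finally have "t * t \<le> t * (M2 * M1 * B v v)" by (simp add: power2_eq_square mult_ac)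
    moreover have "t \<ge> 0" by (simp add: t_def)
    moreover have "B v v \<ge> 0" using nonneg v by simp
    ultimately have t_le: "t \<le> M2 * M1 * B v v"
      using M1 M2 by (cases "t = 0") (auto simp: mult_le_cancel_left)
    have "c\<^sup>2 * (norm (\<iota> v))\<^sup>2 \<le> t"
      unfolding t_def power_mult_distrib[symmetric] using low c by (intro power_mono) auto
    then have "(norm (\<iota> v))\<^sup>2 \<le> M2 * M1 * B v v / c\<^sup>2"
      using t_le c by (simp add: field_simps)
    then have "C * (norm (\<iota> v))\<^sup>2 \<le> C * (M2 * M1 * B v v / c\<^sup>2)" using \<epsilon> by (intro mult_left_mono) auto
    then have "\<epsilon> * (norm v)\<^sup>2 \<le> B v v * (1 + C * (M2 * M1) / c\<^sup>2)"
      using garding[of v] by (simp add: ip power2_norm_eq_inner algebra_simps)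
    then show ?thesis using pos by (simp add: \<delta>_def field_simps)
  qed
  then show ?thesis using pos \<epsilon> by (intro exI[of _ \<delta>]) (auto simp: \<delta>_def)
qed


section \<open>Counting negative directions\<close>

lemma edim_finite_span:
  assumes "finite b" "independent b"
  shows "edim (span b) = enat (card b)"
  using assms dim_span_eq_card_independent[OF assms(2)] by (auto simp: edim_def simp del: dim_span)

text \<open>The supremum is attained because the dimensions of subspaces take finitely many values.\<close>

lemma pos_index_attained:
  fixes Q :: "'a::euclidean_space \<Rightarrow> 'a \<Rightarrow> real"
  obtains b where "finite b" "independent b" "\<And>v. v \<in> span b \<Longrightarrow> v \<noteq> 0 \<Longrightarrow> Q v v > 0"
    "pos_index Q = enat (card b)"
proof -
  let ?A = "{S. subspace S \<and> (\<forall>v\<in>S. v \<noteq> 0 \<longrightarrow> Q v v > 0)}"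
  have ed: "\<exists>b. finite b \<and> independent b \<and> span b = S \<and> edim S = enat (card b)" if "subspace S" for S :: "'a set"
  proof -
    obtain b where b: "b \<subseteq> S" "independent b" "S \<subseteq> span b" using basis_exists[of S] by metis
    then have "span b = S" using that by (simp add: span_minimal subset_antisym)
    moreover have "finite b" using b independent_bound by blast
    ultimately show ?thesis using b edim_finite_span by blast
  qed
  have "edim S \<in> enat ` {..DIM('a)}" if "S \<in> ?A" for S
    using ed[of S] that independent_bound by auto
  then have fin: "finite (edim ` ?A)" by (meson finite_atMost finite_imageI finite_subset image_subsetI)
  have "{0} \<in> ?A" by simp
  then have ne: "edim ` ?A \<noteq> {}" by blast
  have "Sup (edim ` ?A) \<in> edim ` ?A" using Max_in[OF fin ne] unfolding Max_Sup[OF fin ne] .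
  then obtain S where "S \<in> ?A" "pos_index Q = edim S" by (auto simp: pos_index_def)
  then show thesis using ed[of S] that by auto
qed

text \<open>The image under \<open>U\<close> of a maximal positive subspace for \<open>Q\<close> is negative definite for \<open>B\<close> of the
  same dimension. A vector \<open>v \<in> Ker D\<close> with \<open>B v v < 0\<close> is \<open>B\<close>-orthogonal to it and would
  enlarge it, contradicting the equality of the indices.\<close>

lemma nonneg_on_kernel_of_index:
  fixes B :: "'e::real_vector \<Rightarrow> 'e \<Rightarrow> real" and Q :: "'m::euclidean_space \<Rightarrow> 'm \<Rightarrow> real"
  assumes B: "bilinear B" and sym: "\<And>v w. B v w = B w v"
    and U: "linear U" and UD: "\<And>z v. B (U z) v = inner z (D v)" and Q: "\<And>z. Q z z = - B (U z) (U z)"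
    and idx: "pos_index Q = neg_index B" and v: "D v = 0"
  shows "B v v \<ge> 0"
proof (rule ccontr)
  assume neg: "\<not> B v v \<ge> 0"
  obtain b where b: "finite b" "independent b" and pos: "\<And>v. v \<in> span b \<Longrightarrow> v \<noteq> 0 \<Longrightarrow> Q v v > 0"
    and p: "pos_index Q = enat (card b)" using pos_index_attained by blast
  have orth: "B (U z) v = 0" for z by (simp add: UD v)
  have form: "B (t *\<^sub>R v + U z) (t *\<^sub>R v + U z) = t\<^sup>2 * B v v - Q z z" for t z
    by (simp add: bilinear_ladd[OF B] bilinear_radd[OF B] bilinear_lmul[OF B] bilinear_rmul[OF B]
        orth sym[of v "U z"] Q power2_eq_square)
  have Q0: "Q 0 0 = 0" by (simp add: Q linear_0[OF U] bilinear_lzero[OF B])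
  have neg_def: "t\<^sup>2 * B v v - Q z z < 0" if "z \<in> span b" "t \<noteq> 0 \<or> z \<noteq> 0" for t z
  proof (cases "t = 0")
    case False
    then have "t\<^sup>2 * B v v < 0" using neg by (simp add: mult_less_0_iff)
    moreover have "Q z z \<ge> 0" using pos[of z] that Q0 by (cases "z = 0") auto
    ultimately show ?thesis by simp
  qed (use that pos[of z] in simp)
  have zero: "t = 0 \<and> z = 0" if "z \<in> span b" "t *\<^sub>R v + U z = 0" for t z
    using neg_def[OF that(1), of t] form[of t z] that(2) by (auto simp: bilinear_lzero[OF B])
  have inj: "inj_on U (span b)"
    using zero[of _ 0] by (auto simp: linear_inj_on_iff_eq_0[OF U] linear_injective_on_subspace_0[OF U])
  have Ub: "independent (U ` b)" using linear_independent_injective_image[OF U b(2) inj] .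
  have "v \<notin> span (U ` b)"
  proof
    assume "v \<in> span (U ` b)"
    then obtain z where "z \<in> span b" "v = U z" by (auto simp: linear_span_image[OF U])
    then show False using zero[of "- z" 1] span_neg by (auto simp: linear_neg[OF U])
  qed
  then have ind: "independent (insert v (U ` b))" and vn: "v \<notin> U ` b"
    using Ub by (auto simp: independent_insert span_base)
  let ?N = "span (insert v (U ` b))"
  have "edim ?N = enat (Suc (card b))"
    using edim_finite_span[OF _ ind] b vn card_image[OF inj_on_subset[OF inj span_superset]]
    by simp
  moreover have "edim ?N \<le> neg_index B"
    unfolding neg_index_def
  proof (rule SUP_upper, intro CollectI conjI ballI impI)
    fix x assume x: "x \<in> ?N" "x \<noteq> 0"
    then obtain t where "x - t *\<^sub>R v \<in> span (U ` b)" by (auto simp: span_insert)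
    then obtain z where z: "z \<in> span b" "x = t *\<^sub>R v + U z"
      by (auto simp: linear_span_image[OF U] algebra_simps)
    then have "t \<noteq> 0 \<or> z \<noteq> 0" using x linear_0[OF U] by auto
    then show "B x x < 0" using neg_def[OF z(1)] by (simp add: z form)
  qed (rule subspace_span)
  ultimately show False using idx[symmetric] p by simp
qed


section \<open>Hessians of the Lagrangian and of its critical value\<close>

lemma C2_on_UNIV_has_derivative:
  assumes "C2_on UNIV f"
  shows "(f has_derivative blinfun_apply (Fderiv f x)) (at x)"
    and "(Fderiv f has_derivative blinfun_apply (Fderiv (Fderiv f) x)) (at x)"
  using assms by (auto intro!: has_derivative_Fderiv simp: C2_on_def C1_on_def)

lemma Lagr_has_derivative:
  assumes H: "C2_on UNIV H" and F: "C2_on UNIV F"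
  shows "(Lagr H F \<xi> has_derivative
      blinfun_apply (Fderiv H x - (blinfun_inner_right \<xi> o\<^sub>L Fderiv F x))) (at x)"
proof -
  have "((\<lambda>y. H y - inner \<xi> (F y)) has_derivative
      (\<lambda>v. Fderiv H x v - inner \<xi> (Fderiv F x v))) (at x)"
    by (intro has_derivative_diff has_derivative_inner_right C2_on_UNIV_has_derivative H F)
  moreover have "blinfun_apply (Fderiv H x - (blinfun_inner_right \<xi> o\<^sub>L Fderiv F x))
      = (\<lambda>v. Fderiv H x v - inner \<xi> (Fderiv F x v))"
    by (simp add: fun_eq_iff blinfun.bilinear_simps)
  ultimately show ?thesis by (simp add: Lagr_def[abs_def])
qed

lemma Lagr_second_derivative:
  fixes F :: "'e::real_normed_vector \<Rightarrow> real^'m::finite"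
  assumes H: "C2_on UNIV H" and F: "C2_on UNIV F"
  shows "(Fderiv (Lagr H F \<xi>) has_derivative
      (\<lambda>v. Fderiv (Fderiv H) x v - (blinfun_inner_right \<xi> o\<^sub>L Fderiv (Fderiv F) x v))) (at x)"
proof -
  have "Fderiv (Lagr H F \<xi>) = (\<lambda>y. Fderiv H y - (blinfun_inner_right \<xi> o\<^sub>L Fderiv F y))"
    using Fderiv_apply_eqI[OF Lagr_has_derivative[OF H F]] by (auto simp: blinfun_apply_inject)
  moreover have "((\<lambda>y. Fderiv H y - (blinfun_inner_right \<xi> o\<^sub>L Fderiv F y)) has_derivative
      (\<lambda>v. Fderiv (Fderiv H) x v - (blinfun_inner_right \<xi> o\<^sub>L Fderiv (Fderiv F) x v))) (at x)"
    by (rule has_derivative_diff[OF C2_on_UNIV_has_derivative(2)[OF H]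
        bounded_linear.has_derivative[OF
          bounded_bilinear.bounded_linear_right[OF bounded_bilinear_blinfun_compose]
          C2_on_UNIV_has_derivative(2)[OF F]]])
  ultimately show ?thesis by simp
qed

lemma Hess_Lagr:
  fixes F :: "'e::real_normed_vector \<Rightarrow> real^'m::finite"
  assumes H: "C2_on UNIV H" and F: "C2_on UNIV F"
  shows "Hess (Lagr H F \<xi>) x v w =
      Fderiv (Fderiv H) x v w - inner \<xi> (Fderiv (Fderiv F) x v w)"
  unfolding Hess_def Fderiv_apply_eqI[OF Lagr_second_derivative[OF H F]]
  by (simp add: blinfun.bilinear_simps)

lemma Hess_Lagr_symmetric:
  fixes F :: "'e::real_normed_vector \<Rightarrow> real^'m::finite"
  assumes H: "C2_on UNIV H" and F: "C2_on UNIV F"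
  shows "Hess (Lagr H F \<xi>) x v w = Hess (Lagr H F \<xi>) x w v"
  unfolding Hess_def
proof (rule second_derivative_symmetric)
  show "(Lagr H F \<xi> has_derivative blinfun_apply (Fderiv (Lagr H F \<xi>) y)) (at y)" for y
    using Lagr_has_derivative[OF H F] by (intro has_derivative_Fderiv) (auto simp: differentiable_def)
  show "(Fderiv (Lagr H F \<xi>) has_derivative blinfun_apply (Fderiv (Fderiv (Lagr H F \<xi>)) x)) (at x)"
    using Lagr_second_derivative[OF H F] by (intro has_derivative_Fderiv) (auto simp: differentiable_def)
qed

lemma bounded_bilinear_Hess: "bounded_bilinear (Hess f x)"
proof -
  have "bounded_bilinear (\<lambda>v w. blinfun_apply (blinfun_apply (Fderiv (Fderiv f) x) v) w)"
    by (rule bounded_bilinear.comp1[OF bounded_bilinear_blinfun_apply blinfun.bounded_linear_right])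
  then show ?thesis by (simp add: Hess_def[abs_def])
qed

text \<open>This is the critical point equation differentiated with respect to the parameter. The
  multiplier enters twice, through \<open>u \<eta>\<close> and explicitly; the explicit occurrence gives the right-hand side.\<close>

lemma Hess_Lagr_deriv_family:
  fixes F :: "'e::real_normed_vector \<Rightarrow> real^'m::finite" and u :: "real^'m \<Rightarrow> 'e"
  assumes H: "C2_on UNIV H" and F: "C2_on UNIV F" and u: "C1_on \<Omega> u" and \<xi>: "\<xi> \<in> \<Omega>"
    and crit: "\<And>\<eta> v. \<eta> \<in> \<Omega> \<Longrightarrow> Fderiv H (u \<eta>) v - inner \<eta> (Fderiv F (u \<eta>) v) = 0"
  shows "Hess (Lagr H F \<xi>) (u \<xi>) (Fderiv u \<xi> \<zeta>) v = inner \<zeta> (Fderiv F (u \<xi>) v)"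
proof -
  have \<Omega>: "open \<Omega>" and du: "(u has_derivative blinfun_apply (Fderiv u \<xi>)) (at \<xi>)"
    using u \<xi> has_derivative_Fderiv by (auto simp: C1_on_def)
  define E where "E \<eta> = Fderiv H (u \<eta>) - (blinfun_inner_right \<eta> o\<^sub>L Fderiv F (u \<eta>))" for \<eta>
  have "(E has_derivative (\<lambda>\<zeta>. Fderiv (Fderiv H) (u \<xi>) (Fderiv u \<xi> \<zeta>)
      - ((blinfun_inner_right \<xi> o\<^sub>L Fderiv (Fderiv F) (u \<xi>) (Fderiv u \<xi> \<zeta>))
          + (blinfun_inner_right \<zeta> o\<^sub>L Fderiv F (u \<xi>))))) (at \<xi>)"
    unfolding E_def
    by (intro has_derivative_diff bounded_bilinear.FDERIV[OF bounded_bilinear_blinfun_compose]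
        bounded_linear.has_derivative[OF bounded_linear_blinfun_inner_right has_derivative_ident]
        has_derivative_compose[OF du C2_on_UNIV_has_derivative(2)[OF H]]
        has_derivative_compose[OF du C2_on_UNIV_has_derivative(2)[OF F]])
  moreover have "(E has_derivative (\<lambda>\<zeta>. 0)) (at \<xi>)"
  proof (rule has_derivative_transform_within_open[OF has_derivative_const \<Omega> \<xi>])
    show "0 = E \<eta>" if "\<eta> \<in> \<Omega>" for \<eta>
      using crit[OF that] by (intro blinfun_eqI) (simp add: E_def blinfun.bilinear_simps)
  qed
  ultimately have eq: "(\<lambda>\<zeta>. Fderiv (Fderiv H) (u \<xi>) (Fderiv u \<xi> \<zeta>)
      - ((blinfun_inner_right \<xi> o\<^sub>L Fderiv (Fderiv F) (u \<xi>) (Fderiv u \<xi> \<zeta>))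
          + (blinfun_inner_right \<zeta> o\<^sub>L Fderiv F (u \<xi>)))) = (\<lambda>\<zeta>. 0)"
    by (rule has_derivative_unique)
  have "blinfun_apply (Fderiv (Fderiv H) (u \<xi>) (Fderiv u \<xi> \<zeta>)
      - ((blinfun_inner_right \<xi> o\<^sub>L Fderiv (Fderiv F) (u \<xi>) (Fderiv u \<xi> \<zeta>))
          + (blinfun_inner_right \<zeta> o\<^sub>L Fderiv F (u \<xi>)))) v = 0"
    unfolding fun_cong[OF eq] by simp
  then show ?thesis by (simp add: Hess_Lagr[OF H F] blinfun.bilinear_simps)
qed

text \<open>By the critical point equation the variation of \<open>u \<eta>\<close> does not contribute to the first
  derivative, so the gradient of \<open>\<eta> \<mapsto> L\<^sub>\<eta> (u \<eta>)\<close> is \<open>- F (u \<eta>)\<close>.\<close>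

lemma Hess_reduced_Lagr:
  fixes F :: "'e::real_normed_vector \<Rightarrow> real^'m::finite" and u :: "real^'m \<Rightarrow> 'e"
  assumes H: "C2_on UNIV H" and F: "C2_on UNIV F" and u: "C1_on \<Omega> u" and \<xi>: "\<xi> \<in> \<Omega>"
    and crit: "\<And>\<eta> v. \<eta> \<in> \<Omega> \<Longrightarrow> Fderiv H (u \<eta>) v - inner \<eta> (Fderiv F (u \<eta>) v) = 0"
  shows "Hess (\<lambda>\<eta>. Lagr H F \<eta> (u \<eta>)) \<xi> \<zeta> \<theta> = - inner (Fderiv F (u \<xi>) (Fderiv u \<xi> \<zeta>)) \<theta>"
proof -
  have \<Omega>: "open \<Omega>" and du: "\<And>\<eta>. \<eta> \<in> \<Omega> \<Longrightarrow> (u has_derivative blinfun_apply (Fderiv u \<eta>)) (at \<eta>)"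
    using u has_derivative_Fderiv by (auto simp: C1_on_def)
  define W where "W = (\<lambda>\<eta>. Lagr H F \<eta> (u \<eta>))"
  have dW: "- blinfun_inner_right (F (u \<eta>)) = Fderiv W \<eta>" if \<eta>: "\<eta> \<in> \<Omega>" for \<eta>
  proof -
    have "(W has_derivative (\<lambda>\<zeta>. Fderiv H (u \<eta>) (Fderiv u \<eta> \<zeta>)
        - (inner \<eta> (Fderiv F (u \<eta>) (Fderiv u \<eta> \<zeta>)) + inner \<zeta> (F (u \<eta>))))) (at \<eta>)"
      unfolding W_def Lagr_def
      by (intro has_derivative_diff has_derivative_inner has_derivative_ident
          has_derivative_compose[OF du[OF \<eta>] C2_on_UNIV_has_derivative(1)[OF H]]
          has_derivative_compose[OF du[OF \<eta>] C2_on_UNIV_has_derivative(1)[OF F]])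
    from Fderiv_apply_eqI[OF this] show ?thesis
      using crit[OF \<eta>] by (intro blinfun_eqI) (simp add: blinfun.bilinear_simps inner_commute algebra_simps)
  qed
  have "((\<lambda>\<eta>. - blinfun_inner_right (F (u \<eta>))) has_derivative
      (\<lambda>\<zeta>. - blinfun_inner_right (Fderiv F (u \<xi>) (Fderiv u \<xi> \<zeta>)))) (at \<xi>)"
    by (intro has_derivative_minus bounded_linear.has_derivative[OF bounded_linear_blinfun_inner_right]
        has_derivative_compose[OF du[OF \<xi>] C2_on_UNIV_has_derivative(1)[OF F]])
  then have "(Fderiv W has_derivative
      (\<lambda>\<zeta>. - blinfun_inner_right (Fderiv F (u \<xi>) (Fderiv u \<xi> \<zeta>)))) (at \<xi>)"
    by (rule has_derivative_transform_within_open[OF _ \<Omega> \<xi> dW])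
  from Fderiv_apply_eqI[OF this] show ?thesis
    unfolding W_def[symmetric] Hess_def by (simp add: blinfun.bilinear_simps)
qed


section \<open>Coercivity of the Hessian of the Lagrangian\<close>

theorem theorem6p3:
  fixes D :: "'e::banach set"
    and J :: "'e \<Rightarrow> ('e \<Rightarrow>\<^sub>L real)"
    and ip :: "'e \<Rightarrow> 'e \<Rightarrow> real"
    and \<iota> :: "'e \<Rightarrow> 'h::{real_inner, complete_space}"
    and H :: "'e \<Rightarrow> real"
    and G :: "(complex^'n::finite^'n) set"
    and \<kappa> :: "real^'m::finite \<Rightarrow> complex^'n^'n"
    and \<Phi> :: "complex^'n^'n \<Rightarrow> 'e \<Rightarrow> 'e"
    and F :: "'e \<Rightarrow> real^'m"
    and \<Omega> :: "(real^'m) set"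
    and u :: "real^'m \<Rightarrow> 'e"
    and W :: "real^'m \<Rightarrow> real"
    and \<xi> :: "real^'m"
    and B :: "'e \<Rightarrow> 'e \<Rightarrow> real"
    and \<epsilon> C :: real
  assumes triple: "symplectic_Banach_triple D J"
    and scalar_product: "continuous_scalar_product ip"
    and completion: "is_completion ip \<iota>"
    and H: "C2_on UNIV H" "H \<in> Dif D J"
    and group: "matrix_Lie_group G" "connected G" "Lie_algebra_coords G \<kappa>"
    and action: "globally_Hamiltonian D J G \<kappa> \<Phi> F"
    and equivariant: "Ad_star_equivariant G \<kappa> \<Phi> F"
    and F: "C2_on UNIV F"
    and H_invariant: "\<And>g. g \<in> G \<Longrightarrow> H \<circ> \<Phi> g = H"
    and linear_isometric: "\<And>g. g \<in> G \<Longrightarrow> linear (\<Phi> g)"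
      "\<And>g v w. g \<in> G \<Longrightarrow> ip (\<Phi> g v) (\<Phi> g w) = ip v w"
      "\<And>g v. g \<in> G \<Longrightarrow> norm (\<Phi> g v) = norm v"
    and \<Omega>: "open \<Omega>"
    and u: "C1_on \<Omega> u" "\<And>\<eta>. \<eta> \<in> \<Omega> \<Longrightarrow> u \<eta> \<in> D"
    and relative_equilibrium: "\<And>\<eta> v. \<eta> \<in> \<Omega> \<Longrightarrow>
      blinfun_apply (Fderiv H (u \<eta>)) v - inner \<eta> (blinfun_apply (Fderiv F (u \<eta>)) v) = 0"
    and W: "W = (\<lambda>\<eta>. Lagr H F \<eta> (u \<eta>))"
    and \<xi>: "\<xi> \<in> \<Omega>"
    and B: "B = Hess (Lagr H F \<xi>) (u \<xi>)"
    and eps_C: "\<epsilon> > 0" "C > 0"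
    and coercive: "\<And>v. B v v \<ge> \<epsilon> * (norm v)\<^sup>2 - C * ip v v"
    and i: "nondegenerate (Hess W \<xi>)"
    and ii: "form_kernel B = orbit_tangent G \<kappa> \<Phi> F (u \<xi>)"
    and iii: "Inf (ereal ` (op_spectrum \<iota> (op_dom \<iota> B) (form_op \<iota> B) \<inter> {0<..})) > 0"
    and iv: "pos_index (Hess W \<xi>) = neg_index B"
    and v: "\<And>x j. x \<in> group_orbit G \<kappa> \<Phi> F (u \<xi>) \<Longrightarrow>
      \<exists>z \<in> op_dom \<iota> B. \<forall>w. blinfun_apply (Fderiv (\<lambda>y. F y $ j) x) w = ip z w"
  shows "\<exists>\<delta>>0. \<forall>v. v \<in> level_tangent F (u \<xi>) \<and> \<iota> v \<in> orth_compl \<iota> (orbit_tangent G \<kappa> \<Phi> F (u \<xi>)) \<longrightarrow>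
    B v v \<ge> \<delta> * (norm v)\<^sup>2"
proof -
  let ?D = "blinfun_apply (Fderiv F (u \<xi>))" and ?U = "blinfun_apply (Fderiv u \<xi>)"
  have sym: "B v w = B w v" for v w
    unfolding B by (rule Hess_Lagr_symmetric[OF H(1) F])
  have BB: "bounded_bilinear B"
    unfolding B by (rule bounded_bilinear_Hess)
  have bil: "bilinear B"
    using BB by (simp add: bilinear_def bounded_linear.linear bounded_bilinear.bounded_linear_left
        bounded_bilinear.bounded_linear_right)
  have linU: "linear ?U"
    by (rule bounded_linear.linear) (rule blinfun.bounded_linear_right)
  have UD: "B (?U z) w = inner z (?D w)" for z w
    unfolding B by (rule Hess_Lagr_deriv_family[OF H(1) F u(1) \<xi> relative_equilibrium])
  have Q: "Hess W \<xi> z \<theta> = - inner (?D (?U z)) \<theta>" for z \<theta>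
    unfolding W by (rule Hess_reduced_Lagr[OF H(1) F u(1) \<xi> relative_equilibrium])
  have nonneg: "B w w \<ge> 0" if "?D w = 0" for w
    by (rule nonneg_on_kernel_of_index[OF bil sym linU UD _ iv that]) (simp add: Q UD inner_commute)
  have nondeg: "z = 0" if "?D (?U z) = 0" for z
    using i that by (auto simp: nondegenerate_def form_kernel_def Q)
  obtain \<gamma> where \<gamma>: "\<gamma> > 0"
    and gap: "\<And>l. 0 < l \<Longrightarrow> l < \<gamma> \<Longrightarrow> l \<notin> op_spectrum \<iota> (op_dom \<iota> B) (form_op \<iota> B)"
  proof -
    let ?\<sigma> = "op_spectrum \<iota> (op_dom \<iota> B) (form_op \<iota> B)"
    obtain \<gamma> where \<gamma>: "0 < ereal \<gamma>" "ereal \<gamma> < Inf (ereal ` (?\<sigma> \<inter> {0<..}))"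
      using ereal_dense2[OF iii] by blast
    have "l \<notin> ?\<sigma>" if "0 < l" "l < \<gamma>" for l
    proof
      assume "l \<in> ?\<sigma>"
      then have "Inf (ereal ` (?\<sigma> \<inter> {0<..})) \<le> ereal l" using that by (intro Inf_lower) auto
      then have "ereal \<gamma> < ereal l" using \<gamma>(2) by (rule less_le_trans[rotated])
      then show False using that by simp
    qed
    then show ?thesis using that \<gamma>(1) by simp
  qed
  show ?thesis
    using coercive_off_kernel[OF BB sym completion eps_C coercive \<gamma> gap linU
        blinfun.bounded_linear_right UD nondeg nonneg]
    by (simp add: level_tangent_def orth_compl_def ii)
qed

end
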